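(* For all $n>3$, $\mathcal{C}(L_n)=\mathfrak{t}(L_n)_{srn}$, where $L_n$ is the standard filiform Lie algebra with basis $\{e_1,\ldots,e_n\}$ and nonzero Lie brackets $\mu(e_1,e_i)=e_{i+1}$, $i=2,\ldots,n-1$.
   Context: Let $\mathfrak{n}$ be a real nilpotent Lie algebra of dimension $N$ with Lie bracket $[\cdot,\cdot]$. Maximal torus: $\mathfrak{t}(\mathfrak{n})$ denotes a maximal abelian subspace of derivations of $\mathfrak{n}$ diagonalizable over $\mathbb{R}$. Fix a basis $\{e_1,\dots,e_N\}$ of $\mathfrak{n}$ such that $\mathfrak{t}(\mathfrak{n})\subset \mathrm{Diag}(\mathfrak{n})$, the space of operators of $\mathfrak{n}$ that are diagonal in this basis; $\mathrm{Diag}(\mathfrak{n})_{>0}$ denotes the diagonal operators with all diagonal entries positive. Put $\mathfrak{t}(\mathfrak{n})_{\mathrm{tr}>0}=\{D\in\mathfrak{t}(\mathfrak{n}):\mathrm{tr}\,D>0\}$. For $L_n$ the basis is the one given in the claim, and $\mathfrak{t}(L_n)$ is the set of all diagonal derivations $\mathrm{Diag}(d_1,d_2,d_1+d_2,2d_1+d_2,\ldots,(n-2)d_1+d_2)$, $d_1,d_2\in\mathbb{R}$. Strongly Ricci negative derivations: a derivation $D$ of $\mathfrak{n}$ with $\mathrm{tr}\,D>0$ is strongly Ricci negative if the solvable Lie algebra $\mathfrak{s}_D=\mathbb{R}f\oplus\mathfrak{n}$ (semidirect product with $\mathrm{ad} f|_{\mathfrak{n}}=D$) admits an inner product such that $D^t=D$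 (adjoint with respect to the restriction of the inner product to $\mathfrak{n}$), $f\perp\mathfrak{n}$, and the corresponding left-invariant metric on the simply connected Lie group with Lie algebra $\mathfrak{s}_D$ has negative definite Ricci curvature. $\mathfrak{t}(\mathfrak{n})_{srn}$ is the set of all $D\in\mathfrak{t}(\mathfrak{n})$ that are strongly Ricci negative. Moment map: $\mathrm{GL}(\mathfrak{n})$ acts on $V=\Lambda^2\mathfrak{n}^*\otimes\mathfrak{n}$ by $g\cdot\mu=g\mu(g^{-1}\cdot,g^{-1}\cdot)$, with derivative $E\cdot\mu=E\mu(\cdot,\cdot)-\mu(E\cdot,\cdot)-\mu(\cdot,E\cdot)$ for $E\in\mathfrak{gl}(\mathfrak{n})$. Endow $\mathfrak{gl}(\mathfrak{n})$ and $V$ with the inner products making $\{e_i\otimes e^j\}$ and $\{(e^i\wedge e^j)\otimes e_k: i<j\}$ orthonormal. The moment map $\mathrm{m}:V\setminus\{0\}\to\mathrm{sym}(\mathfrak{n})$ (operators symmetric with respect to the inner product making $\{e_i\}$ orthonormal) is defined by $\langle \mathrm{m}(\mu),E\rangle=\frac{1}{|\mu|^2}\langle E\cdot\mu,\mu\rangle$ for all $E\in\mathrm{sym}(\mathfrak{n})$. By convention, set $\mathrm{m}(0)=0$. The cone: let $G_{\mathfrak{t}(\mathfrak{n})}$ be the connected component of the identity of the centralizer of $\mathfrak{t}(\mathfrak{n})$ in $\mathrm{GL}(\mathfrak{n})$. Then $$\mathcal{C}(\mathfrak{n}):=\left(\mathbb{R}_{>0}\,\mathrm{m}\left(\overline{G_{\mathfrak{t}(\mathfrak{n})}\cdot[\cdot,\cdot]}\right)\cap\mathrm{Diag}(\mathfrak{n})+\mathrm{Diag}(\mathfrak{n})_{>0}\right)\cap\mathfrak{t}(\mathfrak{n})_{\mathrm{tr}>0},$$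 i.e. the set of all $D\in\mathfrak{t}(\mathfrak{n})$ with $\mathrm{tr}\,D>0$ of the form $D=r\,\mathrm{m}(\lambda)+E$ with $r>0$, $\lambda$ in the closure (in $V$) of the orbit, $\mathrm{m}(\lambda)\in\mathrm{Diag}(\mathfrak{n})$ and $E\in\mathrm{Diag}(\mathfrak{n})_{>0}$. *)

theory Defs
  imports "HOL-Analysis.Analysis"
begin

text \<open>
  An operator of \<open>\<real>\<^sup>n\<close> is a matrix acting by \<open>*v\<close>. An element \<open>\<mu>\<close> of
  \<open>\<Lambda>\<^sup>2 (\<real>\<^sup>n)\<^sup>* \<otimes> \<real>\<^sup>n\<close> is stored through its values on the standard basis:
  \<open>\<mu> $ i $ j\<close> is the vector \<open>\<mu>(e\<^sub>i, e\<^sub>j)\<close>. The alternating tensors form a closed subspace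
  of \<open>'n tensor\<close>, so a closure in \<open>\<Lambda>\<^sup>2 (\<real>\<^sup>n)\<^sup>* \<otimes> \<real>\<^sup>n\<close> is a closure in \<open>'n tensor\<close>.
\<close>

type_synonym 'n operator = "real ^ 'n ^ 'n"
type_synonym 'n tensor = "((real ^ 'n) ^ 'n) ^ 'n"

definition br :: "'n::finite tensor \<Rightarrow> real ^ 'n \<Rightarrow> real ^ 'n \<Rightarrow> real ^ 'n" where
  "br \<mu> x y = (\<Sum>i\<in>UNIV. \<Sum>j\<in>UNIV. (x $ i * y $ j) *\<^sub>R (\<mu> $ i $ j))"

definition derivation :: "'n::finite tensor \<Rightarrow> 'n operator \<Rightarrow> bool" where
  "derivation \<mu> D \<longleftrightarrow> (\<forall>x y. D *v br \<mu> x y = br \<mu> (D *v x) y + br \<mu> x (D *v y))"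

definition Diag :: "'n::finite operator set" where
  "Diag = {D. \<forall>i j. i \<noteq> j \<longrightarrow> D $ i $ j = 0}"

definition Diag_pos :: "'n::finite operator set" where
  "Diag_pos = {D \<in> Diag. \<forall>i. D $ i $ i > 0}"

definition diagonalizable :: "'n::finite operator \<Rightarrow> bool" where
  "diagonalizable D \<longleftrightarrow> (\<exists>P::'n operator. invertible P \<and> matrix_inv P ** D ** P \<in> Diag)"

definition torus :: "'n::finite tensor \<Rightarrow> 'n operator set \<Rightarrow> bool" where
  "torus \<mu> t \<longleftrightarrow> subspace t \<and> (\<forall>D\<in>t. derivation \<mu> D \<and> diagonalizable D)
     \<and> (\<forall>D\<in>t. \<forall>E\<in>t. D ** E = E ** D)"

definition maximal_torus :: "'n::finite tensor \<Rightarrow> 'n operator set \<Rightarrow> bool" where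
  "maximal_torus \<mu> t \<longleftrightarrow> torus \<mu> t \<and> (\<forall>t'. torus \<mu> t' \<and> t \<subseteq> t' \<longrightarrow> t' = t)"


section \<open>Ricci curvature of left-invariant metrics\<close>

text \<open>
  A left-invariant metric on a Lie group is an inner product \<open>g\<close> on its Lie algebra. The
  Levi-Civita connection maps left-invariant fields to left-invariant fields, and \<open>g\<close> is
  constant on them, so on the Lie algebra it is the bilinear map \<open>nabla\<close> that is torsion free
  and for which \<open>nabla X\<close> is skew-symmetric; see \<open>ex1_levi_civita\<close>. The curvature tensors are
  left-invariant, hence determined by their values on left-invariant fields.
\<close>

definition inner_product :: "('a::real_vector \<Rightarrow> 'a \<Rightarrow> real) \<Rightarrow> bool" where
  "inner_product g \<longleftrightarrow>
     (\<forall>y. linear (\<lambda>x. g x y)) \<and> (\<forall>x y. g x y = g y x) \<and> (\<forall>x. x \<noteq> 0 \<longrightarrow> g x x > 0)"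

definition levi_civita ::
    "('a::real_vector \<Rightarrow> 'a \<Rightarrow> 'a) \<Rightarrow> ('a \<Rightarrow> 'a \<Rightarrow> real) \<Rightarrow> ('a \<Rightarrow> 'a \<Rightarrow> 'a) \<Rightarrow> bool" where
  "levi_civita b g nabla \<longleftrightarrow>
     (\<forall>Y. linear (\<lambda>X. nabla X Y)) \<and> (\<forall>X. linear (nabla X))
     \<and> (\<forall>X Y. nabla X Y - nabla Y X = b X Y)
     \<and> (\<forall>X Y Z. g (nabla X Y) Z + g Y (nabla X Z) = 0)"

definition curvature ::
    "('a::real_vector \<Rightarrow> 'a \<Rightarrow> 'a) \<Rightarrow> ('a \<Rightarrow> 'a \<Rightarrow> 'a) \<Rightarrow> 'a \<Rightarrow> 'a \<Rightarrow> 'a \<Rightarrow> 'a" where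
  "curvature b nabla X Y Z =
     nabla X (nabla Y Z) - nabla Y (nabla X Z) - nabla (b X Y) Z"

text \<open>
  The trace of an endomorphism, computed in the canonical basis of the type. It does not depend
  on a basis, and the inner product \<open>\<bullet>\<close> of the type is unrelated to the metric \<open>g\<close>.
\<close>

definition lin_trace :: "('a::euclidean_space \<Rightarrow> 'a) \<Rightarrow> real" where
  "lin_trace F = (\<Sum>b\<in>Basis. F b \<bullet> b)"

definition ricci ::
    "('a::euclidean_space \<Rightarrow> 'a \<Rightarrow> 'a) \<Rightarrow> ('a \<Rightarrow> 'a \<Rightarrow> 'a) \<Rightarrow> 'a \<Rightarrow> 'a \<Rightarrow> real" where
  "ricci b nabla Y Z = lin_trace (\<lambda>X. curvature b nabla X Y Z)"

definition ricci_negative ::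
    "('a::euclidean_space \<Rightarrow> 'a \<Rightarrow> 'a) \<Rightarrow> ('a \<Rightarrow> 'a \<Rightarrow> real) \<Rightarrow> bool" where
  "ricci_negative b g \<longleftrightarrow>
     (\<exists>nabla. levi_civita b g nabla \<and> (\<forall>X. X \<noteq> 0 \<longrightarrow> ricci b nabla X X < 0))"


section \<open>Strongly Ricci negative derivations\<close>

text \<open>The bracket of \<open>\<real> f \<oplus> \<real>\<^sup>n\<close> with \<open>ad f = D\<close> on \<open>\<real>\<^sup>n\<close>; here \<open>f = (1, 0)\<close>.\<close>

definition semidirect_br ::
    "'n::finite tensor \<Rightarrow> 'n operator \<Rightarrow> real \<times> (real ^ 'n) \<Rightarrow> real \<times> (real ^ 'n)
      \<Rightarrow> real \<times> (real ^ 'n)" where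
  "semidirect_br \<mu> D X Y =
     (0, fst X *\<^sub>R (D *v snd Y) - fst Y *\<^sub>R (D *v snd X) + br \<mu> (snd X) (snd Y))"

definition strongly_ricci_negative :: "'n::finite tensor \<Rightarrow> 'n operator \<Rightarrow> bool" where
  "strongly_ricci_negative \<mu> D \<longleftrightarrow> derivation \<mu> D \<and> trace D > 0 \<and>
     (\<exists>g. inner_product g
        \<and> (\<forall>x y. g (0, D *v x) (0, y) = g (0, x) (0, D *v y))
        \<and> (\<forall>x. g (1, 0) (0, x) = 0)
        \<and> ricci_negative (semidirect_br \<mu> D) g)"

definition srn :: "'n::finite tensor \<Rightarrow> 'n operator set \<Rightarrow> 'n operator set" where
  "srn \<mu> t = {D \<in> t. strongly_ricci_negative \<mu> D}"


section \<open>The moment map and the cone\<close>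

definition gl_act :: "'n::finite operator \<Rightarrow> 'n tensor \<Rightarrow> 'n tensor" where
  "gl_act g \<mu> =
     (\<chi> i j. g *v br \<mu> (matrix_inv g *v axis i 1) (matrix_inv g *v axis j 1))"

definition gl_deriv_act :: "'n::finite operator \<Rightarrow> 'n tensor \<Rightarrow> 'n tensor" where
  "gl_deriv_act E \<mu> =
     (\<chi> i j. E *v br \<mu> (axis i 1) (axis j 1)
        - br \<mu> (E *v axis i 1) (axis j 1) - br \<mu> (axis i 1) (E *v axis j 1))"

text \<open>
  On alternating tensors the factor \<open>1/2\<close> turns the sum over all \<open>(i, j)\<close> into the sum over
  \<open>i < j\<close>, so that the \<open>(e\<^sup>i \<and> e\<^sup>j) \<otimes> e\<^sub>k\<close> with \<open>i < j\<close> are orthonormal.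
\<close>

definition inner_V :: "'n::finite tensor \<Rightarrow> 'n tensor \<Rightarrow> real" where
  "inner_V \<mu> \<nu> = (\<Sum>i\<in>UNIV. \<Sum>j\<in>UNIV. (\<mu> $ i $ j) \<bullet> (\<nu> $ i $ j)) / 2"

text \<open>
  On matrices \<open>\<bullet>\<close> is the inner product for which the matrix units are orthonormal.
  The description determines a unique matrix; see \<open>moment_map_unique\<close>.
\<close>

definition moment_map :: "'n::finite tensor \<Rightarrow> 'n operator" where
  "moment_map \<mu> = (if \<mu> = 0 then 0 else
     (THE M. transpose M = M \<and>
        (\<forall>E. transpose E = E \<longrightarrow> M \<bullet> E = inner_V (gl_deriv_act E \<mu>) \<mu> / inner_V \<mu> \<mu>)))"

definition centralizer :: "'n::finite operator set \<Rightarrow> 'n operator set" where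
  "centralizer t = {g. invertible g \<and> (\<forall>D\<in>t. g ** D = D ** g)}"

definition G0 :: "'n::finite operator set \<Rightarrow> 'n operator set" where
  "G0 t = connected_component_set (centralizer t) (mat 1)"

definition cone_C :: "'n::finite tensor \<Rightarrow> 'n operator set \<Rightarrow> 'n operator set" where
  "cone_C \<mu> t = {D \<in> t. trace D > 0 \<and>
     (\<exists>r>0. \<exists>\<nu>\<in>closure ((\<lambda>g. gl_act g \<mu>) ` G0 t). \<exists>E\<in>Diag_pos.
        moment_map \<nu> \<in> Diag \<and> D = r *\<^sub>R moment_map \<nu> + E)}"


section \<open>The standard filiform Lie algebra\<close>

text \<open>
  The index type is unordered, and \<open>l\<close>, a bijection from \<open>{1..n}\<close> onto it, lists the standard
  basis: \<open>e\<^sub>i = axis (l i) 1\<close>. The set \<open>filiform_torus n l\<close> of all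
  \<open>Diag(d1, d2, d1 + d2, 2 d1 + d2, \<dots>, (n - 2) d1 + d2)\<close> consists of all diagonal derivations
  and is a maximal torus; see \<open>filiform_torus_eq\<close> and \<open>maximal_torus_filiform_torus\<close>.
\<close>

definition filiform :: "nat \<Rightarrow> (nat \<Rightarrow> 'n::finite) \<Rightarrow> 'n tensor" where
  "filiform n l = (\<chi> p q. \<Sum>i\<in>{2..n-1}.
     (if p = l 1 \<and> q = l i then axis (l (i + 1)) 1
      else if p = l i \<and> q = l 1 then - axis (l (i + 1)) 1 else 0))"

definition filiform_torus :: "nat \<Rightarrow> (nat \<Rightarrow> 'n::finite) \<Rightarrow> 'n operator set" where
  "filiform_torus n l = {D \<in> Diag. \<exists>d1 d2. D $ l 1 $ l 1 = d1 \<and>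
     (\<forall>i\<in>{2..n}. D $ l i $ l i = real (i - 2) * d1 + d2)}"


section \<open>The definitions are meaningful\<close>

lemma br_axis [simp]: "br \<mu> (axis i 1) (axis j 1) = \<mu> $ i $ j"
proof -
  have "br \<mu> (axis i 1) (axis j 1)
      = (\<Sum>a\<in>UNIV. \<Sum>c\<in>UNIV. if c = j then (if a = i then \<mu> $ a $ c else 0) else 0)"
    unfolding br_def by (intro sum.cong refl) (auto simp: axis_def)
  then show ?thesis by simp
qed

lemma inner_V_eq: "inner_V \<mu> \<nu> = (\<mu> \<bullet> \<nu>) / 2"
  by (simp add: inner_V_def inner_vec_def)

lemma linear_gl_deriv: "linear (\<lambda>E. inner_V (gl_deriv_act E \<mu>) \<mu> / inner_V \<mu> \<mu>)"
proof -
  have 1: "gl_deriv_act (E + F) \<mu> = gl_deriv_act E \<mu> + gl_deriv_act F \<mu>" for E F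
    by (simp add: gl_deriv_act_def vec_eq_iff br_def matrix_vector_mult_add_rdistrib
        algebra_simps sum.distrib)
  have 2: "gl_deriv_act (c *\<^sub>R E) \<mu> = c *\<^sub>R gl_deriv_act E \<mu>" for c E
    by (simp add: gl_deriv_act_def vec_eq_iff br_def scaleR_matrix_vector_assoc[symmetric]
        algebra_simps sum_distrib_left)
  show ?thesis
    by (rule linearI)
       (simp_all add: 1 2 inner_V_eq inner_add_left add_divide_distrib)
qed

lemma transpose_inner: "transpose A \<bullet> transpose B = (A::real^'n^'n) \<bullet> B"
proof -
  have "(\<Sum>i\<in>UNIV. \<Sum>j\<in>UNIV. A $ j $ i * B $ j $ i) = (\<Sum>i\<in>UNIV. \<Sum>j\<in>UNIV. A $ i $ j * B $ i $ j)"
    by (rule sum.swap)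
  then show ?thesis by (simp add: inner_vec_def transpose_def)
qed

lemma moment_map_unique:
  fixes \<mu> :: "'n::finite tensor"
  shows "\<exists>!M. transpose M = M \<and>
    (\<forall>E. transpose E = E \<longrightarrow> M \<bullet> E = inner_V (gl_deriv_act E \<mu>) \<mu> / inner_V \<mu> \<mu>)"
proof -
  define \<phi> where "\<phi> = (\<lambda>E. inner_V (gl_deriv_act E \<mu>) \<mu> / inner_V \<mu> \<mu>)"
  have lin: "linear \<phi>" unfolding \<phi>_def by (rule linear_gl_deriv)
  define N where "N = adjoint \<phi> 1"
  have N: "N \<bullet> E = \<phi> E" for E
    using adjoint_works[OF lin, of E 1] by (simp add: N_def inner_commute)
  define M where "M = (1/2::real) *\<^sub>R (N + transpose N)"
  have M_sym: "transpose M = M"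
    by (simp add: M_def transpose_def vec_eq_iff)
  have M: "M \<bullet> E = \<phi> E" if "transpose E = E" for E
    using transpose_inner[of N E] N[of E] that by (simp add: M_def inner_add_left)
  have uniq: "M' = M" if s: "transpose M' = M'"
    and e: "\<forall>E. transpose E = E \<longrightarrow> M' \<bullet> E = \<phi> E" for M'
  proof -
    have d: "transpose (M' - M) = M' - M"
      using s M_sym by (simp add: transpose_def vec_eq_iff)
    have "(M' - M) \<bullet> (M' - M) = 0"
      using e d M[OF d] by (simp add: inner_diff_left)
    then show ?thesis by simp
  qed
  have "\<exists>!M. transpose M = M \<and> (\<forall>E. transpose E = E \<longrightarrow> M \<bullet> E = \<phi> E)"
  proof (rule ex1I[of _ M])
    show "transpose M = M \<and> (\<forall>E. transpose E = E \<longrightarrow> M \<bullet> E = \<phi> E)"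
      using M_sym M by simp
  qed (use uniq in simp)
  then show ?thesis by (simp only: \<phi>_def)
qed

lemma linear_br_left: "linear (\<lambda>x. br \<mu> x y)"
proof (rule linearI)
  show "br \<mu> (x + x') y = br \<mu> x y + br \<mu> x' y" for x x'
    by (simp add: br_def distrib_right scaleR_add_left sum.distrib)
  show "br \<mu> (c *\<^sub>R x) y = c *\<^sub>R br \<mu> x y" for c x
    unfolding br_def scaleR_sum_right by (intro sum.cong refl) simp
qed

lemma linear_br_right: "linear (br \<mu> x)"
proof (rule linearI)
  show "br \<mu> x (y + y') = br \<mu> x y + br \<mu> x y'" for y y'
    by (simp add: br_def distrib_left scaleR_add_left sum.distrib)
  show "br \<mu> x (c *\<^sub>R y) = c *\<^sub>R br \<mu> x y" for c y
    unfolding br_def scaleR_sum_right by (intro sum.cong refl) simp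
qed

lemma inner_product_riesz:
  fixes g :: "'a::euclidean_space \<Rightarrow> 'a \<Rightarrow> real"
  assumes "inner_product g" and "linear \<phi>"
  shows "\<exists>!v. \<forall>Z. g v Z = \<phi> Z"
proof -
  have gl: "linear (\<lambda>x. g x y)" and sym: "g x y = g y x"
    and pos: "x \<noteq> 0 \<Longrightarrow> g x x > 0" for x y
    using assms(1) by (auto simp: inner_product_def)
  have gr: "linear (g x)" for x
  proof -
    have "g x = (\<lambda>y. g y x)" using sym by blast
    then show ?thesis using gl[of x] by simp
  qed
  define T where "T = (\<lambda>v. \<Sum>b\<in>Basis. g v b *\<^sub>R b)"
  have T: "T v \<bullet> Z = g v Z" for v Z
  proof -
    have "T v \<bullet> Z = (\<Sum>b\<in>Basis. g v b * (b \<bullet> Z))"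
      by (simp add: T_def inner_sum_left)
    also have "\<dots> = (\<Sum>b\<in>Basis. (Z \<bullet> b) *\<^sub>R g v b)"
      by (simp add: inner_commute mult.commute)
    also have "\<dots> = g v (\<Sum>b\<in>Basis. (Z \<bullet> b) *\<^sub>R b)"
      by (simp only: linear_sum[OF gr] linear_scale[OF gr])
    finally show ?thesis by (simp add: euclidean_representation)
  qed
  have "T (x + y) = T x + T y" for x y
    by (rule euclidean_eqI) (simp add: T inner_add_left, simp add: linear_add[OF gl])
  moreover have "T (c *\<^sub>R x) = c *\<^sub>R T x" for c x
    by (rule euclidean_eqI) (simp add: T, simp add: linear_scale[OF gl])
  ultimately have linT: "linear T" by (rule linearI)
  have injT: "inj T"
  proof (subst linear_injective_0[OF linT], intro allI impI)
    fix v assume "T v = 0"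
    then show "v = 0" using T[of v v] pos[of v] by fastforce
  qed
  have "surj T" using linT injT by (simp add: linear_injective_imp_surjective)
  then obtain v where v: "T v = adjoint \<phi> 1" by (metis surjD)
  have "g v Z = \<phi> Z" for Z
    using adjoint_works[OF assms(2), of Z 1] T[of v Z] v by (simp add: inner_commute)
  moreover have "w = v" if "\<forall>Z. g w Z = \<phi> Z" for w
    using injT T calculation that by (metis injD vector_eq_rdot)
  ultimately show ?thesis by blast
qed

lemma ex1_levi_civita:
  fixes b :: "'a::euclidean_space \<Rightarrow> 'a \<Rightarrow> 'a"
  assumes g: "inner_product g"
    and bl: "\<And>Y. linear (\<lambda>X. b X Y)" and br: "\<And>X. linear (b X)"
    and skew: "\<And>X Y. b X Y = - b Y X"
  shows "\<exists>!nabla. levi_civita b g nabla"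
proof -
  have gl: "linear (\<lambda>x. g x y)" and sym: "g x y = g y x" for x y
    using g by (auto simp: inner_product_def)
  have gr: "linear (g x)" for x
  proof -
    have "g x = (\<lambda>y. g y x)" using sym by blast
    then show ?thesis using gl[of x] by simp
  qed
  note gs = linear_add[OF gl] linear_scale[OF gl] linear_add[OF gr] linear_scale[OF gr]
    linear_diff[OF gl] linear_diff[OF gr] linear_neg[OF gl] linear_neg[OF gr]
    linear_add[OF bl] linear_scale[OF bl] linear_add[OF br] linear_scale[OF br]
  define K where "K = (\<lambda>X Y Z. (g (b X Y) Z - g (b Y Z) X + g (b Z X) Y) / 2)"
  have "linear (K X Y)" for X Y
    by (rule linearI) (simp_all add: K_def gs field_simps)
  then have ex1: "\<exists>!v. \<forall>Z. g v Z = K X Y Z" for X Y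
    using inner_product_riesz[OF g] by blast
  define N where "N = (\<lambda>X Y. THE v. \<forall>Z. g v Z = K X Y Z)"
  have N: "g (N X Y) Z = K X Y Z" for X Y Z
    using theI'[OF ex1[of X Y]] by (simp add: N_def)
  have eqI: "v = w" if "\<And>Z. g v Z = g w Z" for v w
    using inner_product_riesz[OF g gr[of w]] that by blast
  have "levi_civita b g N"
    unfolding levi_civita_def
  proof (intro conjI allI)
    show "linear (\<lambda>X. N X Y)" for Y
      by (rule linearI; rule eqI) (simp_all add: gs N K_def field_simps)
    show "linear (N X)" for X
      by (rule linearI; rule eqI) (simp_all add: gs N K_def field_simps)
    show "N X Y - N Y X = b X Y" for X Y
    proof (rule eqI)
      fix Z
      have "g (b Y X) Z = - g (b X Y) Z" "g (b X Z) Y = - g (b Z X) Y"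
        "g (b Z Y) X = - g (b Y Z) X"
        using skew[of Y X] skew[of X Z] skew[of Z Y] by (simp_all add: gs)
      then show "g (N X Y - N Y X) Z = g (b X Y) Z"
        by (simp add: gs N K_def field_simps)
    qed
    show "g (N X Y) Z + g Y (N X Z) = 0" for X Y Z
    proof -
      have "g (b Y X) Z = - g (b X Y) Z" "g (b X Z) Y = - g (b Z X) Y"
        "g (b Z Y) X = - g (b Y Z) X"
        using skew[of Y X] skew[of X Z] skew[of Z Y] by (simp_all add: gs)
      then show ?thesis
        using sym[of Y "N X Z"] by (simp add: N K_def field_simps)
    qed
  qed
  moreover have "M = N" if M: "levi_civita b g M" for M
  proof (intro ext eqI)
    fix X Y Z
    have t: "M X Y - M Y X = b X Y" and c: "g (M X Y) Z + g Y (M X Z) = 0" for X Y Z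
      using M by (auto simp: levi_civita_def)
    have "g (b X Y) Z = g (M X Y) Z - g (M Y X) Z"
      "g (b Y Z) X = g (M Y Z) X - g (M Z Y) X"
      "g (b Z X) Y = g (M Z X) Y - g (M X Z) Y"
      by (simp_all add: t[symmetric] gs)
    then have "K X Y Z = g (M X Y) Z"
      using c[of X Y Z] c[of Y Z X] c[of Z X Y] sym[of Y "M X Z"] sym[of Z "M Y X"]
        sym[of X "M Z Y"]
      by (simp add: K_def field_simps)
    then show "g (M X Y) Z = g (N X Y) Z" by (simp add: N)
  qed
  ultimately show ?thesis by blast
qed

context
  fixes n :: nat and l :: "nat \<Rightarrow> 'n::finite"
  assumes l: "bij_betw l {1..n} UNIV"
begin

lemma l_eq_iff: "i \<in> {1..n} \<Longrightarrow> j \<in> {1..n} \<Longrightarrow> l i = l j \<longleftrightarrow> i = j"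
  using inj_on_eq_iff[OF bij_betw_imp_inj_on[OF l]] .

lemma l_cases: obtains i where "i \<in> {1..n}" "p = l i"
proof -
  have "p \<in> l ` {1..n}" using bij_betw_imp_surj_on[OF l] by simp
  then show ?thesis using that by blast
qed

lemma filiform_brackets:
  assumes "i \<in> {1..n}" "j \<in> {1..n}"
  shows "br (filiform n l) (axis (l i) 1) (axis (l j) 1) =
    (if i = 1 \<and> 2 \<le> j \<and> j \<le> n - 1 then axis (l (j + 1)) 1
     else if j = 1 \<and> 2 \<le> i \<and> i \<le> n - 1 then - axis (l (i + 1)) 1 else 0)"
proof -
  have 1: "1 \<in> {1..n}" using assms by simp
  have "br (filiform n l) (axis (l i) 1) (axis (l j) 1) = (\<Sum>k\<in>{2..n-1}.
     (if k = j then if i = 1 then axis (l (j + 1)) 1 else 0 else 0) +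
     (if k = i then if j = 1 then - axis (l (i + 1)) 1 else 0 else 0))"
    unfolding br_axis filiform_def vec_lambda_beta
  proof (intro sum.cong refl)
    fix k assume k: "k \<in> {2..n-1}"
    then have "k \<in> {1..n}" "k \<noteq> 1" by auto
    then show "(if l i = l 1 \<and> l j = l k then axis (l (k + 1)) 1
        else if l i = l k \<and> l j = l 1 then - axis (l (k + 1)) 1 else 0) =
      (if k = j then if i = 1 then axis (l (j + 1)) 1 else 0 else 0) +
      (if k = i then if j = 1 then - axis (l (i + 1)) (1::real) else 0 else 0)"
      using assms 1 by (auto simp del: One_nat_def simp add: l_eq_iff)
  qed
  then show ?thesis by (auto simp: sum.distrib)
qed

lemma filiform_torus_eq:
  assumes n: "3 < n"
  shows "filiform_torus n l = {D \<in> Diag. derivation (filiform n l) D}"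
proof -
  let ?\<mu> = "filiform n l"
  have D_axis: "D *v axis p 1 = (D $ p $ p) *\<^sub>R axis p 1" if "D \<in> Diag" for D :: "'n operator" and p
  proof -
    have "(D *v axis p 1) $ q = ((D $ p $ p) *\<^sub>R axis p 1) $ q" for q
      using that by (cases "q = p")
        (auto simp: Diag_def axis_def matrix_vector_mult_basis[unfolded axis_def] column_def)
    then show ?thesis unfolding vec_eq_iff by blast
  qed
  note lins = linear_add[OF linear_br_left] linear_scale[OF linear_br_left]
    linear_add[OF linear_br_right] linear_scale[OF linear_br_right]
  have der_iff: "derivation ?\<mu> D \<longleftrightarrow>
      (\<forall>j\<in>{2..n-1}. D $ l (j+1) $ l (j+1) = D $ l 1 $ l 1 + D $ l j $ l j)" (is "_ \<longleftrightarrow> ?R")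
    if D: "D \<in> Diag" for D
  proof
    assume d: "derivation ?\<mu> D"
    show ?R
    proof
      fix j assume j: "j \<in> {2..n-1}"
      have b: "br ?\<mu> (axis (l 1) 1) (axis (l j) 1) = axis (l (j+1)) 1"
        using j n filiform_brackets[of 1 j] by (auto simp del: br_axis)
      have e: "D *v br ?\<mu> (axis (l 1) 1) (axis (l j) 1)
          = br ?\<mu> (D *v axis (l 1) 1) (axis (l j) 1) + br ?\<mu> (axis (l 1) 1) (D *v axis (l j) 1)"
        using d unfolding derivation_def by blast
      then have "(D $ l (j+1) $ l (j+1)) *\<^sub>R (axis (l (j+1)) 1 :: real^'n) =
          (D $ l 1 $ l 1 + D $ l j $ l j) *\<^sub>R axis (l (j+1)) 1"
        using e by (simp only: D_axis[OF D] lins b scaleR_add_left)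
      then show "D $ l (j+1) $ l (j+1) = D $ l 1 $ l 1 + D $ l j $ l j"
        by (simp add: scaleR_cancel_right axis_eq_0_iff)
    qed
  next
    assume R: ?R
    have ax: "D *v br ?\<mu> (axis p 1) (axis q 1)
        = br ?\<mu> (D *v axis p 1) (axis q 1) + br ?\<mu> (axis p 1) (D *v axis q 1)" for p q
    proof -
      obtain i j where i: "i \<in> {1..n}" "p = l i" and j: "j \<in> {1..n}" "q = l j"
        by (metis l_cases)
      have R': "(D $ l (k + 1) $ l (k + 1)) *\<^sub>R v
          = (D $ l k $ l k) *\<^sub>R v + (D $ l 1 $ l 1) *\<^sub>R v"
        if "2 \<le> k" "k \<le> n - 1" for k and v :: "real^'n"
        using R that by (simp add: scaleR_left_distrib)
      show ?thesis
        using i j n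
        by (auto simp: D_axis[OF D] lins filiform_brackets R' linear_neg[OF matrix_vector_mul_linear]
            simp del: br_axis One_nat_def)
    qed
    show "derivation ?\<mu> D"
      unfolding derivation_def
    proof (intro allI)
      fix x y
      let ?L = "\<lambda>x y. D *v br ?\<mu> x y - br ?\<mu> (D *v x) y - br ?\<mu> x (D *v y)"
      have l1: "linear (\<lambda>x. ?L x y)" for y
        by (rule linearI) (simp_all add: lins matrix_vector_right_distrib
          matrix_vector_mult_scaleR algebra_simps)
      have l2: "linear (?L x)" for x
        by (rule linearI) (simp_all add: lins matrix_vector_right_distrib
          matrix_vector_mult_scaleR algebra_simps)
      have bas: "b \<in> Basis \<longleftrightarrow> (\<exists>p. b = axis p 1)" for b :: "real^'n"
        by (auto simp: Basis_vec_def)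
      have a: "?L (axis p 1) y = 0" for p
      proof -
        have "?L (axis p 1) = (\<lambda>y. 0)"
        proof (rule linear_eq_stdbasis[OF l2])
          show "linear (\<lambda>y::real^'n. 0::real^'n)" by (rule linear_zero)
          fix b :: "real^'n" assume "b \<in> Basis"
          then show "?L (axis p 1) b = 0" using ax[of p] by (auto simp: bas simp del: br_axis)
        qed
        then show ?thesis by meson
      qed
      have "(\<lambda>x. ?L x y) = (\<lambda>x. 0)"
      proof (rule linear_eq_stdbasis[OF l1])
        show "linear (\<lambda>y::real^'n. 0::real^'n)" by (rule linear_zero)
        fix b :: "real^'n" assume "b \<in> Basis"
        then show "?L b y = 0" using a by (auto simp: bas simp del: br_axis)
      qed
      then have "?L x y = 0" by meson
      then show "D *v br ?\<mu> x y = br ?\<mu> (D *v x) y + br ?\<mu> x (D *v y)"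
        by (simp add: algebra_simps)
    qed
  qed
  have "(\<exists>d1 d2. D $ l 1 $ l 1 = d1 \<and> (\<forall>i\<in>{2..n}. D $ l i $ l i = real (i - 2) * d1 + d2))
      \<longleftrightarrow> (\<forall>j\<in>{2..n-1}. D $ l (j+1) $ l (j+1) = D $ l 1 $ l 1 + D $ l j $ l j)"
    (is "?A \<longleftrightarrow> ?B") for D :: "'n operator"
  proof
    assume ?A
    then obtain d2 where d2: "\<And>i. i \<in> {2..n} \<Longrightarrow> D $ l i $ l i = real (i - 2) * D $ l 1 $ l 1 + d2"
      by blast
    show ?B
    proof
      fix j assume "j \<in> {2..n-1}"
      then have "2 \<le> j" "j \<in> {2..n}" "j + 1 \<in> {2..n}" using n by auto
      then show "D $ l (j+1) $ l (j+1) = D $ l 1 $ l 1 + D $ l j $ l j"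
        using d2[of j] d2[of "j+1"] by (simp add: algebra_simps of_nat_diff)
    qed
  next
    assume B: ?B
    have "2 + k \<le> n \<Longrightarrow> D $ l (2 + k) $ l (2 + k) = real k * D $ l 1 $ l 1 + D $ l 2 $ l 2" for k
    proof (induction k)
      case (Suc k)
      then show ?case using bspec[OF B, of "2 + k"] by (auto simp: algebra_simps)
    qed simp
    then have "\<forall>i\<in>{2..n}. D $ l i $ l i = real (i - 2) * D $ l 1 $ l 1 + D $ l 2 $ l 2"
      by (metis atLeastAtMost_iff le_add_diff_inverse)
    then show ?A by blast
  qed
  then show ?thesis
    unfolding filiform_torus_def using der_iff by auto
qed

lemma maximal_torus_filiform_torus:
  assumes n: "3 < n"
  shows "maximal_torus (filiform n l) (filiform_torus n l)"
proof -
  let ?\<mu> = "filiform n l" and ?t = "filiform_torus n l"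
  have mult_Diag: "(A ** D) $ p $ q = A $ p $ q * D $ q $ q"
    "(D ** A) $ p $ q = D $ p $ p * A $ p $ q"
    if D: "D \<in> Diag" for A D :: "'n operator" and p q
  proof -
    have "(A ** D) $ p $ q = (\<Sum>k\<in>UNIV. if k = q then A $ p $ q * D $ q $ q else 0)"
      unfolding matrix_matrix_mult_def vec_lambda_beta using D
      by (intro sum.cong refl) (auto simp: Diag_def)
    then show "(A ** D) $ p $ q = A $ p $ q * D $ q $ q" by simp
    have "(D ** A) $ p $ q = (\<Sum>k\<in>UNIV. if k = p then D $ p $ p * A $ p $ q else 0)"
      unfolding matrix_matrix_mult_def vec_lambda_beta using D
      by (intro sum.cong refl) (auto simp: Diag_def)
    then show "(D ** A) $ p $ q = D $ p $ p * A $ p $ q" by simp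
  qed
  have "subspace ?t"
  proof (rule subspaceI)
    show "0 \<in> ?t" by (auto simp: filiform_torus_def Diag_def intro!: exI[of _ 0])
    fix D E :: "'n operator" and c :: real
    assume "D \<in> ?t"
    then obtain b where D: "D \<in> Diag"
      "\<And>i. i \<in> {2..n} \<Longrightarrow> D $ l i $ l i = real (i - 2) * D $ l 1 $ l 1 + b"
      by (auto simp: filiform_torus_def)
    show "c *\<^sub>R D \<in> ?t"
      using D by (auto simp: filiform_torus_def Diag_def distrib_left mult.left_commute
          intro!: exI[of _ "c * b"])
    assume "E \<in> ?t"
    then obtain b' where E: "E \<in> Diag"
      "\<And>i. i \<in> {2..n} \<Longrightarrow> E $ l i $ l i = real (i - 2) * E $ l 1 $ l 1 + b'"
      by (auto simp: filiform_torus_def)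
    show "D + E \<in> ?t"
      using D E by (auto simp: filiform_torus_def Diag_def distrib_left intro!: exI[of _ "b + b'"])
  qed
  moreover have "derivation ?\<mu> D \<and> diagonalizable D" if "D \<in> ?t" for D
  proof -
    have "invertible (mat 1 :: 'n operator)" by (metis invertible_def matrix_mul_lid)
    moreover have "matrix_inv (mat 1 :: 'n operator) = mat 1"
      unfolding matrix_inv_def by (rule some_equality) auto
    ultimately have "diagonalizable D"
      using that filiform_torus_eq[OF n] unfolding diagonalizable_def
      by (metis (lifting) matrix_mul_lid matrix_mul_rid mem_Collect_eq)
    then show ?thesis using that filiform_torus_eq[OF n] by auto
  qed
  moreover have "D ** E = E ** D" if "D \<in> ?t" "E \<in> ?t" for D E
  proof -
    have "D \<in> Diag" "E \<in> Diag" using that by (auto simp: filiform_torus_def)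
    then have "(D ** E) $ p $ q = (E ** D) $ p $ q" for p q
      using mult_Diag[of E D p q] by (cases "p = q") (auto simp: Diag_def)
    then show ?thesis unfolding vec_eq_iff by blast
  qed
  ultimately have tor: "torus ?\<mu> ?t" by (simp add: torus_def)
  define m where "m = inv_into {1..n} l"
  have m: "m (l i) = i" if "i \<in> {1..n}" for i
    using l that by (simp add: m_def bij_betw_inv_into_left)
  define D0 :: "'n operator" where
    "D0 = (\<chi> p q. if p = q then (if m p = 1 then 1 else real (m p - 2) + real n) else 0)"
  have D0_Diag: "D0 \<in> Diag" by (simp add: D0_def Diag_def)
  have D0: "D0 \<in> ?t"
    using n D0_Diag by (auto simp: filiform_torus_def D0_def m intro!: exI[of _ "real n"])
  have dist: "D0 $ p $ p \<noteq> D0 $ q $ q" if "p \<noteq> q" for p q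
  proof -
    obtain i j where "i \<in> {1..n}" "p = l i" "j \<in> {1..n}" "q = l j"
      by (metis l_cases)
    then show ?thesis using that n by (auto simp: D0_def m of_nat_diff split: if_splits)
  qed
  have "t' = ?t" if t': "torus ?\<mu> t'" "?t \<subseteq> t'" for t'
  proof
    show "t' \<subseteq> ?t"
    proof
      fix A assume A: "A \<in> t'"
      then have c: "A ** D0 = D0 ** A" and d: "derivation ?\<mu> A"
        using t' D0 by (auto simp: torus_def)
      have "A $ p $ q = 0" if "p \<noteq> q" for p q
      proof -
        have "A $ p $ q * D0 $ q $ q = D0 $ p $ p * A $ p $ q"
          using c mult_Diag[OF D0_Diag] by metis
        then show ?thesis using dist[OF that] by (auto simp: mult.commute)
      qed
      then have "A \<in> Diag" by (simp add: Diag_def)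
      then show "A \<in> ?t" using d filiform_torus_eq[OF n] by simp
    qed
  qed (use t' in simp)
  with tor show ?thesis by (simp add: maximal_torus_def)
qed

end

end

theory Submission
  imports Defs
begin

text \<open>
  Write \<open>D\<^sub>i\<close> for the diagonal entries of \<open>D\<close>. Both sets turn out to consist of the
  \<open>D\<close> in the torus with \<open>tr D > 0\<close>, \<open>D\<^sub>n > 0\<close> and \<open>D\<^sub>2 + \<dots> + D\<^sub>n > 0\<close>.

  For a diagonal metric on \<open>L\<^sub>n\<close> or a point of the orbit closure, the Ricci operator
  respectively the moment map is a nonnegative combination of the \<open>F\<^sub>i = E\<^sub>i\<^sub>+\<^sub>1 - E\<^sub>1 - E\<^sub>i\<close>, where
  \<open>E\<^sub>i = e\<^sub>i \<otimes> e\<^sup>i\<close> and \<open>2 \<le> i \<le> n - 1\<close>. Hence membership in either set follows from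
  \<open>D - \<Sum>b\<^sub>i F\<^sub>i > 0\<close> for some \<open>b\<^sub>i > 0\<close>, and such \<open>b\<^sub>i\<close> are found by summing
  \<open>D\<^sub>i\<^sub>+\<^sub>1, \<dots>, D\<^sub>n\<close>. Conversely, \<open>F\<^sub>i\<close> has a nonnegative \<open>n\<close>-th entry, and trace \<open>0\<close> on
  the abelian ideal spanned by \<open>e\<^sub>2, \<dots>, e\<^sub>n\<close>, which makes the two inequalities necessary for
  the cone. For an arbitrary metric with symmetric \<open>D\<close> the same two facts survive: on the
  centre \<open>\<real> e\<^sub>n\<close> the nilpotent part of Ric is nonnegative, and on the abelian ideal of
  codimension one it has trace \<open>0\<close>.
\<close>

subsection \<open>Orthonormal bases and traces\<close>

lemma inner_product_linear_left: "inner_product g \<Longrightarrow> linear (\<lambda>x. g x y)"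
  by (simp add: inner_product_def)

lemma inner_product_sym: "inner_product g \<Longrightarrow> g x y = g y x"
  by (simp add: inner_product_def)

lemma inner_product_pos: "inner_product g \<Longrightarrow> x \<noteq> 0 \<Longrightarrow> g x x > 0"
  by (simp add: inner_product_def)

lemma inner_product_linear_right:
  assumes "inner_product g"
  shows "linear (g x)"
proof -
  have "g x = (\<lambda>y. g y x)" using inner_product_sym[OF assms] by blast
  then show ?thesis using inner_product_linear_left[OF assms, of x] by simp
qed

lemmas inner_product_simps =
  linear_add[OF inner_product_linear_left] linear_scale[OF inner_product_linear_left]
  linear_diff[OF inner_product_linear_left] linear_neg[OF inner_product_linear_left]
  linear_0[OF inner_product_linear_left] linear_sum[OF inner_product_linear_left]
  linear_add[OF inner_product_linear_right] linear_scale[OF inner_product_linear_right]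
  linear_diff[OF inner_product_linear_right] linear_neg[OF inner_product_linear_right]
  linear_0[OF inner_product_linear_right] linear_sum[OF inner_product_linear_right]

text \<open>Completeness is stated as the expansion of every vector, the form in which traces use
  it. The index set is free because both \<open>{..<n}\<close> and \<open>{1..n}\<close>
  occur.\<close>

definition orthonormal_basis ::
    "('a::real_vector \<Rightarrow> 'a \<Rightarrow> real) \<Rightarrow> 'i set \<Rightarrow> ('i \<Rightarrow> 'a) \<Rightarrow> bool" where
  "orthonormal_basis g I v \<longleftrightarrow> finite I
     \<and> (\<forall>i\<in>I. \<forall>j\<in>I. g (v i) (v j) = (if i = j then 1 else 0))
     \<and> (\<forall>x. (\<Sum>i\<in>I. g x (v i) *\<^sub>R v i) = x)"

lemma orthonormal_basisI:
  assumes g: "inner_product g" and fin: "finite I"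
    and on: "\<And>i j. i \<in> I \<Longrightarrow> j \<in> I \<Longrightarrow> g (v i) (v j) = (if i = j then 1 else 0)"
    and sp: "span (v ` I) = UNIV"
  shows "orthonormal_basis g I v"
proof -
  note gs = inner_product_simps[OF g]
  have "(\<Sum>i\<in>I. g x (v i) *\<^sub>R v i) = x" for x
  proof -
    have "x \<in> span (v ` I)" using sp by simp
    then show ?thesis
    proof (induction rule: span_induct)
      case base
      show ?case
      proof (rule subspaceI)
        show "0 \<in> {x. (\<Sum>i\<in>I. g x (v i) *\<^sub>R v i) = x}" by (simp add: gs)
      next
        fix x y assume "x \<in> {x. (\<Sum>i\<in>I. g x (v i) *\<^sub>R v i) = x}" "y \<in> {x. (\<Sum>i\<in>I. g x (v i) *\<^sub>R v i) = x}"
        then show "x + y \<in> {x. (\<Sum>i\<in>I. g x (v i) *\<^sub>R v i) = x}"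
          by (simp add: gs scaleR_add_left sum.distrib)
      next
        fix c x assume "x \<in> {x. (\<Sum>i\<in>I. g x (v i) *\<^sub>R v i) = x}"
        then have "c *\<^sub>R (\<Sum>i\<in>I. g x (v i) *\<^sub>R v i) = c *\<^sub>R x" by simp
        then show "c *\<^sub>R x \<in> {x. (\<Sum>i\<in>I. g x (v i) *\<^sub>R v i) = x}"
          by (simp add: gs scaleR_sum_right)
      qed
    next
      case (step x)
      then obtain j where j: "j \<in> I" "x = v j" by blast
      have "(\<Sum>i\<in>I. g x (v i) *\<^sub>R v i) = (\<Sum>i\<in>I. if i = j then v j else 0)"
        using j on by (intro sum.cong refl) auto
      then show ?case using j fin by simp
    qed
  qed
  then show ?thesis using fin on by (auto simp: orthonormal_basis_def)
qed

text \<open>Induction: subtract from \<open>w n\<close> its projection onto the earlier vectors and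
  normalise. Preserving every span in the flag, not only the last, is what makes adapted orthonormal
  bases available for the filiform ideals.\<close>

lemma gram_schmidt:
  fixes w :: "nat \<Rightarrow> 'a::real_vector"
  assumes g: "inner_product g" and ind: "\<And>m. m < n \<Longrightarrow> w m \<notin> span (w ` {..<m})"
  shows "\<exists>u. (\<forall>i<n. \<forall>j<n. g (u i) (u j) = (if i = j then 1 else 0))
    \<and> (\<forall>m\<le>n. span (u ` {..<m}) = span (w ` {..<m}))"
  using ind
proof (induction n)
  case (Suc n)
  note gs = inner_product_simps[OF g]
  from Suc obtain u where on: "\<And>i j. i < n \<Longrightarrow> j < n \<Longrightarrow> g (u i) (u j) = (if i = j then 1 else 0)"
    and sp: "\<And>m. m \<le> n \<Longrightarrow> span (u ` {..<m}) = span (w ` {..<m})" by auto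
  define p where "p = (\<Sum>k<n. g (w n) (u k) *\<^sub>R u k)"
  define z where "z = w n - p"
  have p: "p \<in> span (u ` {..<n})"
    unfolding p_def by (intro span_sum span_scale span_base) auto
  have "z \<noteq> 0" using p sp[of n] Suc.prems[of n] by (auto simp: z_def)
  then have c: "g z z > 0" by (rule inner_product_pos[OF g])
  have zu: "g z (u j) = 0" if "j < n" for j
  proof -
    have "(\<Sum>k<n. g (w n) (u k) * g (u k) (u j)) = (\<Sum>k<n. if k = j then g (w n) (u j) else 0)"
      using that on by (intro sum.cong refl) auto
    then show ?thesis using that by (simp add: z_def p_def gs)
  qed
  define u' where "u' = u(n := (1 / sqrt (g z z)) *\<^sub>R z)"
  have im: "u' ` {..<m} = u ` {..<m}" if "m \<le> n" for m
    using that by (intro image_cong refl) (auto simp: u'_def)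
  have "g (u' i) (u' j) = (if i = j then 1 else 0)" if ij: "i < Suc n" "j < Suc n" for i j
  proof -
    consider "i = n" "j = n" | "i = n" "j < n" | "i < n" "j = n" | "i < n" "j < n"
      using ij by (auto simp: less_Suc_eq)
    then show ?thesis
    proof cases
      case 1 then show ?thesis using c by (simp add: u'_def gs)
    next
      case 2 then show ?thesis using zu[of j] by (simp add: u'_def gs)
    next
      case 3 then show ?thesis
        using zu[of i] inner_product_sym[OF g, of z "u i"] by (simp add: u'_def gs)
    next
      case 4 then show ?thesis using on[of i j] by (simp add: u'_def)
    qed
  qed
  moreover have "span (u' ` {..<m}) = span (w ` {..<m})" if "m \<le> Suc n" for m
  proof (cases "m = Suc n")
    case True
    have i: "u' ` {..<Suc n} = insert ((1 / sqrt (g z z)) *\<^sub>R z) (u ` {..<n})"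
      "w ` {..<Suc n} = insert (w n) (w ` {..<n})"
      unfolding lessThan_Suc image_insert im[OF order_refl] by (simp_all add: u'_def)
    let ?U = "span (insert ((1 / sqrt (g z z)) *\<^sub>R z) (u ` {..<n}))"
    let ?W = "span (insert (w n) (w ` {..<n}))"
    have mono: "span (u ` {..<n}) \<subseteq> ?U" "span (w ` {..<n}) \<subseteq> ?W"
      by (intro span_mono; blast)+
    have "p \<in> ?W" "p \<in> ?U" using p sp[of n] mono by auto
    have "z \<in> ?W" unfolding z_def using \<open>p \<in> ?W\<close> by (intro span_diff) (auto intro: span_base)
    have "(sqrt (g z z)) *\<^sub>R ((1 / sqrt (g z z)) *\<^sub>R z) \<in> ?U"
      by (intro span_scale span_base) simp
    then have "z \<in> ?U" using c by simp
    then have "w n \<in> ?U" using \<open>p \<in> ?U\<close> span_add[of z _ p] by (simp add: z_def)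
    have "?U = ?W"
      unfolding span_eq using \<open>z \<in> ?W\<close> \<open>w n \<in> ?U\<close> mono sp[of n]
        span_superset[of "u ` {..<n}"] span_superset[of "w ` {..<n}"]
      by (auto intro: span_scale)
    then show ?thesis using True i by simp
  next
    case False
    then show ?thesis using that sp im by simp
  qed
  ultimately show ?case by blast
qed simp

lemma orthonormal_basis_exists:
  fixes g :: "'a::euclidean_space \<Rightarrow> 'a \<Rightarrow> real"
  assumes g: "inner_product g"
  shows "\<exists>(u :: nat \<Rightarrow> 'a) n. orthonormal_basis g {..<n} u"
proof -
  obtain w :: "nat \<Rightarrow> 'a" and n where w: "bij_betw w {..<n} Basis"
    using ex_bij_betw_nat_finite[OF finite_Basis, where ?'a1='a] by (auto simp: atLeast0LessThan)
  have "w m \<notin> span (w ` {..<m})" if m: "m < n" for m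
  proof -
    have "w ` {..<m} \<subseteq> Basis - {w m}"
    proof
      fix x assume "x \<in> w ` {..<m}"
      then obtain i where "i < m" "x = w i" by blast
      then show "x \<in> Basis - {w m}"
        using w m by (auto simp: bij_betw_def inj_on_def)
    qed
    moreover have "w m \<in> Basis" using w m by (auto simp: bij_betw_def)
    ultimately show ?thesis
      using independent_Basis[where ?'a='a] span_mono unfolding dependent_def by blast
  qed
  then obtain u where "\<forall>i<n. \<forall>j<n. g (u i) (u j) = (if i = j then 1 else 0)"
    and sp: "span (u ` {..<n}) = span (w ` {..<n})"
    using gram_schmidt[OF g, of n w] by blast
  moreover have "span (u ` {..<n}) = UNIV"
    using w sp by (simp add: bij_betw_def)
  ultimately have "orthonormal_basis g {..<n} u"
    by (intro orthonormal_basisI[OF g]) auto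
  then show ?thesis by blast
qed

text \<open>Expand each canonical basis vector in \<open>v\<close>, exchange the sums, and
  reassemble \<open>F (v i)\<close> from its canonical coordinates. This links the trace in
  \<open>ricci\<close>, taken in the canonical basis, to the metric \<open>g\<close>.\<close>

lemma lin_trace_orthonormal:
  fixes g :: "'a::euclidean_space \<Rightarrow> 'a \<Rightarrow> real"
  assumes g: "inner_product g" and v: "orthonormal_basis g I v" and F: "linear F"
  shows "lin_trace F = (\<Sum>i\<in>I. g (F (v i)) (v i))"
proof -
  note gs = inner_product_simps[OF g]
  have "lin_trace F = (\<Sum>b\<in>Basis. \<Sum>i\<in>I. g b (v i) * (F (v i) \<bullet> b))"
    unfolding lin_trace_def
  proof (intro sum.cong refl)
    fix b :: 'a
    have "b = (\<Sum>i\<in>I. g b (v i) *\<^sub>R v i)" using v unfolding orthonormal_basis_def by metis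
    then have "F b = F (\<Sum>i\<in>I. g b (v i) *\<^sub>R v i)" by metis
    then show "F b \<bullet> b = (\<Sum>i\<in>I. g b (v i) * (F (v i) \<bullet> b))"
      by (simp add: linear_sum[OF F] linear_scale[OF F] inner_sum_left)
  qed
  also have "\<dots> = (\<Sum>i\<in>I. \<Sum>b\<in>Basis. g b (v i) * (F (v i) \<bullet> b))" by (rule sum.swap)
  also have "\<dots> = (\<Sum>i\<in>I. g (\<Sum>b\<in>Basis. (F (v i) \<bullet> b) *\<^sub>R b) (v i))"
    by (simp add: gs mult.commute)
  finally show ?thesis by (simp add: euclidean_representation)
qed

lemma lin_trace_square_orthonormal:
  fixes g :: "'a::euclidean_space \<Rightarrow> 'a \<Rightarrow> real"
  assumes g: "inner_product g" and v: "orthonormal_basis g I v" and F: "linear F"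
  shows "lin_trace (\<lambda>x. F (F x)) = (\<Sum>i\<in>I. \<Sum>j\<in>I. g (F (v i)) (v j) * g (F (v j)) (v i))"
proof -
  note gs = inner_product_simps[OF g]
  have "lin_trace (\<lambda>x. F (F x)) = (\<Sum>i\<in>I. g (F (F (v i))) (v i))"
    using linear_compose[OF F F] by (intro lin_trace_orthonormal[OF g v]) (simp add: o_def)
  also have "\<dots> = (\<Sum>i\<in>I. \<Sum>j\<in>I. g (F (v i)) (v j) * g (F (v j)) (v i))"
  proof (intro sum.cong refl)
    fix i
    have "F (v i) = (\<Sum>j\<in>I. g (F (v i)) (v j) *\<^sub>R v j)"
      using v unfolding orthonormal_basis_def by metis
    then have "F (F (v i)) = F (\<Sum>j\<in>I. g (F (v i)) (v j) *\<^sub>R v j)" by metis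
    then show "g (F (F (v i))) (v i) = (\<Sum>j\<in>I. g (F (v i)) (v j) * g (F (v j)) (v i))"
      by (simp add: linear_sum[OF F] linear_scale[OF F] gs)
  qed
  finally show ?thesis .
qed

text \<open>All diagonal entries of \<open>F\<close> in a \<open>g\<close>-orthonormal basis
  vanish.\<close>

lemma lin_trace_skew:
  fixes g :: "'a::euclidean_space \<Rightarrow> 'a \<Rightarrow> real"
  assumes g: "inner_product g" and F: "linear F" and skew: "\<And>x. g (F x) x = 0"
  shows "lin_trace F = 0"
  using orthonormal_basis_exists[OF g] lin_trace_orthonormal[OF g _ F] skew by fastforce

lemma lin_trace_add: "lin_trace (\<lambda>x. F x + G x) = lin_trace F + lin_trace G"
  by (simp add: lin_trace_def inner_add_left sum.distrib)

lemma lin_trace_diff: "lin_trace (\<lambda>x. F x - G x) = lin_trace F - lin_trace G"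
  by (simp add: lin_trace_def inner_diff_left sum_subtractf)

lemma lin_trace_comm:
  fixes F G :: "'a::euclidean_space \<Rightarrow> 'a"
  assumes F: "linear F" and G: "linear G"
  shows "lin_trace (\<lambda>x. F (G x)) = lin_trace (\<lambda>x. G (F x))"
proof -
  have *: "lin_trace (\<lambda>x. F (G x)) = (\<Sum>b\<in>Basis. \<Sum>c\<in>Basis. (G b \<bullet> c) * (F c \<bullet> b))"
    if F: "linear F" for F G :: "'a \<Rightarrow> 'a"
    unfolding lin_trace_def
  proof (intro sum.cong refl)
    fix b :: 'a
    have "F (G b) = F (\<Sum>c\<in>Basis. (G b \<bullet> c) *\<^sub>R c)" by (simp add: euclidean_representation)
    then show "F (G b) \<bullet> b = (\<Sum>c\<in>Basis. (G b \<bullet> c) * (F c \<bullet> b))"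
      by (simp only: linear_sum[OF F] linear_scale[OF F] inner_sum_left inner_scaleR_left)
  qed
  show ?thesis
    unfolding *[OF F] *[OF G] by (subst sum.swap) (simp add: mult.commute)
qed

lemma lin_trace_prod:
  fixes F :: "real \<times> 'a::euclidean_space \<Rightarrow> real \<times> 'a"
  shows "lin_trace F = fst (F (1, 0)) + lin_trace (\<lambda>x. snd (F (0, x)))"
proof -
  have "lin_trace F = (\<Sum>b\<in>(\<lambda>u::real. (u, 0)) ` Basis \<union> (\<lambda>v::'a. (0, v)) ` Basis. F b \<bullet> b)"
    by (simp add: lin_trace_def Basis_prod_def)
  also have "\<dots> = (\<Sum>b\<in>(\<lambda>u::real. (u, 0::'a)) ` Basis. F b \<bullet> b) + (\<Sum>b\<in>(\<lambda>v::'a. (0, v)) ` Basis. F b \<bullet> b)"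
    by (rule sum.union_disjoint) auto
  also have "(\<Sum>b\<in>(\<lambda>v::'a. (0::real, v)) ` Basis. F b \<bullet> b) = (\<Sum>b\<in>Basis. F (0, b) \<bullet> (0, b))"
    by (subst sum.reindex) (auto simp: inj_on_def)
  finally show ?thesis by (simp add: lin_trace_def inner_prod_def)
qed

lemma lin_trace_matrix:
  fixes F :: "real ^ 'n \<Rightarrow> real ^ 'n"
  shows "lin_trace F = (\<Sum>p\<in>UNIV. F (axis p 1) $ p)"
proof -
  have "bij_betw (\<lambda>p. axis p 1) UNIV (Basis :: (real ^ 'n) set)"
    by (auto simp: bij_betw_def inj_on_def axis_eq_axis Basis_vec_def)
  then have "lin_trace F = (\<Sum>p\<in>UNIV. F (axis p 1) \<bullet> axis p 1)"
    unfolding lin_trace_def by (rule sum.reindex_bij_betw[symmetric])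
  then show ?thesis by (simp add: inner_axis)
qed

lemma lin_trace_matrix_vector: "lin_trace (\<lambda>x. D *v x) = trace (D :: real ^ 'n ^ 'n)"
  by (simp add: lin_trace_matrix trace_def matrix_vector_mult_basis column_def)

subsection \<open>Ricci curvature\<close>

text \<open>The torsion identity turns the three brackets into six terms. Compatibility with
  \<open>g\<close> cancels the four derivatives along \<open>Y\<close> and \<open>Z\<close> and
  makes the two along \<open>X\<close> equal.\<close>

lemma koszul:
  assumes g: "inner_product g" and N: "levi_civita b g nabla"
  shows "2 * g (nabla X Y) Z = g (b X Y) Z - g (b Y Z) X + g (b Z X) Y"
proof -
  note gs = inner_product_simps[OF g]
  have t: "nabla X Y - nabla Y X = b X Y" and c: "g (nabla X Y) Z + g Y (nabla X Z) = 0" for X Y Z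
    using N by (auto simp: levi_civita_def)
  have "g (b X Y) Z = g (nabla X Y) Z - g (nabla Y X) Z"
    "g (b Y Z) X = g (nabla Y Z) X - g (nabla Z Y) X"
    "g (b Z X) Y = g (nabla Z X) Y - g (nabla X Z) Y"
    by (simp_all add: t[symmetric] gs)
  then show ?thesis
    using c[of X Y Z] c[of Y Z X] c[of Z X Y] inner_product_sym[OF g, of Y "nabla X Z"]
      inner_product_sym[OF g, of Z "nabla Y X"] inner_product_sym[OF g, of X "nabla Z Y"]
    by simp
qed

text \<open>
  With \<open>A X = \<nabla>\<^sub>X Y\<close>, torsion-freeness shows that \<open>X \<mapsto> R(X, Y) Y\<close> differs from
  \<open>X \<mapsto> \<nabla>\<^sub>X (\<nabla>\<^sub>Y Y) - A (A X)\<close> by the commutator of \<open>A\<close> and \<open>\<nabla>\<^sub>Y\<close>, and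
  \<open>\<nabla>\<^sub>W\<close> is skew, so no Jacobi identity is needed.
\<close>

lemma ricci_eq:
  fixes b :: "'a::euclidean_space \<Rightarrow> 'a \<Rightarrow> 'a"
  assumes g: "inner_product g" and N: "levi_civita b g nabla"
  shows "ricci b nabla Y Y
    = lin_trace (\<lambda>X. b X (nabla Y Y)) - lin_trace (\<lambda>X. nabla (nabla X Y) Y)"
proof -
  have t: "b X Y = nabla X Y - nabla Y X" and c: "g (nabla X Y) Z + g Y (nabla X Z) = 0"
    and l1: "linear (\<lambda>X. nabla X Y)" and l2: "linear (nabla X)" for X Y Z
    using N by (auto simp: levi_civita_def)
  have skew: "lin_trace (nabla W) = 0" for W
  proof (rule lin_trace_skew[OF g l2])
    show "g (nabla W x) x = 0" for x
      using c[of W x x] inner_product_sym[OF g, of x "nabla W x"] by simp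
  qed
  define W where "W = nabla Y Y"
  have "curvature b nabla X Y Y =
      ((b X W + nabla W X) - nabla (nabla X Y) Y)
      + (nabla (nabla Y X) Y - nabla Y (nabla X Y))" for X
    by (simp add: curvature_def t W_def linear_diff[OF l1])
  then have "ricci b nabla Y Y = lin_trace (\<lambda>X. b X W) + lin_trace (nabla W)
      - lin_trace (\<lambda>X. nabla (nabla X Y) Y)
      + (lin_trace (\<lambda>X. nabla (nabla Y X) Y) - lin_trace (\<lambda>X. nabla Y (nabla X Y)))"
    by (simp only: ricci_def lin_trace_add lin_trace_diff)
  then show ?thesis
    using lin_trace_comm[OF l1[of Y] l2[of Y]] skew W_def by simp
qed

section \<open>Left-invariant metrics on the semidirect product with a symmetric operator\<close>

lemma inner_product_restrict:
  fixes g :: "'a::real_vector \<times> 'b::real_vector \<Rightarrow> 'a \<times> 'b \<Rightarrow> real"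
  assumes g: "inner_product g"
  shows "inner_product (\<lambda>x y. g (0, x) (0, y))"
  unfolding inner_product_def
proof (intro conjI allI impI)
  note gs = inner_product_simps[OF g]
  have p: "(0 :: 'a, x + y) = (0, x) + (0, y)" "(0 :: 'a, c *\<^sub>R x) = c *\<^sub>R (0, x)"
    for x y :: 'b and c :: real by simp_all
  show "linear (\<lambda>x. g (0, x) (0, y))" for y
    by (rule linearI) (simp_all only: p gs)
  show "g (0, x) (0, y) = g (0, y) (0, x)" for x y by (rule inner_product_sym[OF g])
  show "0 < g (0, x) (0, x)" if "x \<noteq> 0" for x
    using that by (intro inner_product_pos[OF g]) (simp add: zero_prod_def)
qed

lemma linear_semidirect_br_left: "linear (\<lambda>X. semidirect_br \<mu> D X Y)"
  by (rule linearI) (simp_all add: semidirect_br_def matrix_vector_right_distrib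
      matrix_vector_mult_scaleR linear_add[OF linear_br_left] linear_scale[OF linear_br_left]
      algebra_simps)

lemma linear_semidirect_br_right: "linear (semidirect_br \<mu> D X)"
  by (rule linearI) (simp_all add: semidirect_br_def matrix_vector_right_distrib
      matrix_vector_mult_scaleR linear_add[OF linear_br_right] linear_scale[OF linear_br_right]
      algebra_simps)

context
  fixes \<mu> :: "'n::finite tensor" and D :: "'n operator"
    and g :: "real \<times> (real ^ 'n) \<Rightarrow> real \<times> (real ^ 'n) \<Rightarrow> real"
    and nabla :: "real \<times> (real ^ 'n) \<Rightarrow> real \<times> (real ^ 'n) \<Rightarrow> real \<times> (real ^ 'n)"
  assumes g: "inner_product g"
    and perp: "\<forall>x. g (1, 0) (0, x) = 0"
    and sym: "\<forall>x y. g (0, D *v x) (0, y) = g (0, x) (0, D *v y)"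
    and skew: "\<And>x y. br \<mu> x y = - br \<mu> y x"
    and unimodular: "\<And>x. lin_trace (\<lambda>y. br \<mu> y x) = 0"
    and lc: "levi_civita (semidirect_br \<mu> D) g nabla"
begin

private abbreviation "h x y \<equiv> g (0, x) (0, y)"

private lemmas gs = inner_product_simps[OF g]
private lemmas hs = inner_product_simps[OF inner_product_restrict[OF g]]

lemma g_split: "g (a, x) (c, y) = a * c * g (1, 0) (1, 0) + h x y"
proof -
  have s: "(a, x) = a *\<^sub>R (1, 0) + (0, x)" for a and x :: "real ^ 'n" by simp
  have "g (0, x) (1, 0) = 0" for x using perp inner_product_sym[OF g] by metis
  then show ?thesis
    using perp by (subst s[of a x], subst s[of c y]) (simp add: gs del: scaleR_Pair add_Pair)
qed

text \<open>The right side of \<open>g_split\<close> contains instances of its left side. Naming the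
  restricted metric \<open>k\<close> and the squared norm \<open>N\<close> of \<open>f\<close> gives
  an equation that can be used for rewriting.\<close>

lemma g_split_obtain:
  obtains k N where "\<And>a x c y. g (a, x) (c, y) = a * c * N + k x y" "N > 0"
    "inner_product k" "\<And>x y. k (D *v x) y = k x (D *v y)"
proof -
  have "g (1, 0) (1, 0) > 0" by (rule inner_product_pos[OF g]) (simp add: zero_prod_def)
  then show ?thesis
    using sym inner_product_restrict[OF g] by (intro that[OF g_split]) auto
qed

lemma g_eqI: "u = w" if "\<And>Z. g u Z = g w Z"
  using inner_product_riesz[OF g inner_product_linear_right[OF g, of w]] that by blast

lemma nabla_linear: "linear (\<lambda>X. nabla X Y)" "linear (nabla X)"
  using lc unfolding levi_civita_def by blast+

text \<open>Brackets have no \<open>f\<close> component, so the Koszul formula leaves only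
  \<open>h (D y) z - h (D z) y\<close>, which vanishes because \<open>D\<close> is
  symmetric.\<close>

lemma nabla_normal: "nabla (1, 0) Y = 0"
proof (rule g_eqI)
  fix Z :: "real \<times> (real ^ 'n)"
  obtain a y c z where YZ: "Y = (a, y)" "Z = (c, z)" by fastforce
  obtain k N where k: "\<And>a x c y. g (a, x) (c, y) = a * c * N + k x y" "inner_product k"
    "\<And>x y. k (D *v x) y = k x (D *v y)"
    using g_split_obtain by metis
  have "2 * g (nabla (1, 0) Y) Z = 0"
    unfolding koszul[OF g lc] using inner_product_sym[OF k(2), of z "D *v y"]
    by (simp add: YZ semidirect_br_def k inner_product_simps[OF k(2)]
        linear_0[OF linear_br_left] linear_0[OF linear_br_right])
  then show "g (nabla (1, 0) Y) Z = g 0 Z" by (simp add: gs)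
qed

text \<open>The bracket of \<open>(0, x)\<close> with \<open>(a, y)\<close> contributes
  \<open>- a D x\<close>. In the Koszul formula this term appears twice, with equal values by
  symmetry of \<open>D\<close>, which absorbs the factor 2.\<close>

lemma nabla_tangent:
  "g (nabla (0, x) (a, y)) (0, z)
    = (h (br \<mu> x y) z + h (br \<mu> z y) x + h (br \<mu> z x) y) / 2 - a * h (D *v x) z"
proof -
  obtain k N where k: "\<And>a x c y. g (a, x) (c, y) = a * c * N + k x y" "inner_product k"
    "\<And>x y. k (D *v x) y = k x (D *v y)"
    using g_split_obtain by metis
  note ks = inner_product_simps[OF k(2)]
  have "k z (D *v x) = k x (D *v z)" using k(3)[of x z] inner_product_sym[OF k(2), of z "D *v x"] by simp
  moreover have "k (br \<mu> y z) x = - k (br \<mu> z y) x"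
    using skew[of y z] ks(4) by simp
  ultimately have "2 * g (nabla (0, x) (a, y)) (0, z)
      = k (br \<mu> x y) z + k (br \<mu> z y) x + k (br \<mu> z x) y - 2 * (a * k (D *v x) z)"
    unfolding koszul[OF g lc] by (simp add: semidirect_br_def k(1,3) ks)
  then show ?thesis by (simp add: k(1) field_simps)
qed

text \<open>For \<open>Y = (a, y)\<close> the Koszul formula against \<open>f\<close> reduces to
  \<open>g [f, Y] Y\<close>. Dividing by the squared norm of \<open>f\<close> converts an inner
  product with \<open>f\<close> into a coordinate.\<close>

lemma fst_nabla: "fst (nabla (a, y) (a, y)) = h (D *v y) y / g (1, 0) (1, 0)"
proof -
  obtain k N where k: "\<And>a x c y. g (a, x) (c, y) = a * c * N + k x y" "N > 0" "inner_product k"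
    using g_split_obtain by metis
  note ks = inner_product_simps[OF k(3)]
  obtain c w where w: "nabla (a, y) (a, y) = (c, w)" by fastforce
  have "br \<mu> y y = 0" using skew[of y y] unfolding vec_eq_iff by simp
  then have "2 * g (nabla (a, y) (a, y)) (1, 0) = 2 * k (D *v y) y"
    unfolding koszul[OF g lc]
    by (simp add: semidirect_br_def k(1) ks linear_0[OF linear_br_left] linear_0[OF linear_br_right])
  then have "c * N = k (D *v y) y" by (simp add: w k(1) ks)
  then show ?thesis using k(2) by (simp add: w k(1) ks field_simps)
qed

text \<open>By \<open>unimodular\<close>, the first trace in \<open>ricci_eq\<close> sees only the
  \<open>f\<close> component of \<open>nabla Y Y\<close>. The second is the trace of the square of
  \<open>X \<mapsto> nabla X Y\<close>, and lives on the nilpotent part since \<open>nabla\<close>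
  vanishes along \<open>f\<close>. Splitting that map into its symmetric and skew parts gives a sum
  of squares minus a sum of squares.\<close>

lemma ricci_semidirect:
  assumes v: "orthonormal_basis (\<lambda>x y. g (0, x) (0, y)) I v"
  shows "ricci (semidirect_br \<mu> D) nabla (a, y) (a, y) =
    - trace D * h (D *v y) y / g (1, 0) (1, 0)
    - (\<Sum>i\<in>I. \<Sum>j\<in>I.
        ((h (br \<mu> (v i) y) (v j) + h (br \<mu> (v j) y) (v i)) / 2 - a * h (D *v v i) (v j))\<^sup>2
        - (h (br \<mu> (v j) (v i)) y)\<^sup>2 / 4)"
proof -
  let ?Y = "(a, y)"
  obtain c w where w: "nabla ?Y ?Y = (c, w)" by fastforce
  have "lin_trace (\<lambda>X. semidirect_br \<mu> D X (nabla ?Y ?Y))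
      = lin_trace (\<lambda>x. - c *\<^sub>R (D *v x) + br \<mu> x w)"
    by (subst lin_trace_prod) (simp add: w semidirect_br_def)
  also have "\<dots> = - c * trace D"
    unfolding lin_trace_add unimodular lin_trace_matrix_vector[symmetric]
    by (simp add: lin_trace_def sum_distrib_left sum_negf)
  finally have 1: "lin_trace (\<lambda>X. semidirect_br \<mu> D X (nabla ?Y ?Y)) = - c * trace D" .
  define A where "A = (\<lambda>x. snd (nabla (0, x) ?Y))"
  have linA: "linear A"
  proof (rule linearI)
    show "A (x + x') = A x + A x'" for x x'
      using linear_add[OF nabla_linear(1), of "(0, x)" "(0, x')" ?Y] by (simp add: A_def)
    show "A (r *\<^sub>R x) = r *\<^sub>R A x" for r x
      using linear_scale[OF nabla_linear(1), of r "(0, x)" ?Y] by (simp add: A_def)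
  qed
  have fac: "nabla X ?Y = nabla (0, snd X) ?Y" for X
    using linear_add[OF nabla_linear(1), of "fst X *\<^sub>R (1, 0)" "(0, snd X)" ?Y]
      linear_scale[OF nabla_linear(1), of "fst X" "(1, 0)" ?Y]
    by (simp add: nabla_normal)
  have "lin_trace (\<lambda>X. nabla (nabla X ?Y) ?Y) = lin_trace (\<lambda>x. A (A x))"
    by (subst lin_trace_prod, subst (2) fac) (simp add: A_def nabla_normal linear_0[OF nabla_linear(1)])
  also have "\<dots> = (\<Sum>i\<in>I. \<Sum>j\<in>I. h (A (v i)) (v j) * h (A (v j)) (v i))"
    by (rule lin_trace_square_orthonormal[OF inner_product_restrict[OF g] v linA])
  also have "\<dots> = (\<Sum>i\<in>I. \<Sum>j\<in>I.
        ((h (br \<mu> (v i) y) (v j) + h (br \<mu> (v j) y) (v i)) / 2 - a * h (D *v v i) (v j))\<^sup>2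
        - (h (br \<mu> (v j) (v i)) y)\<^sup>2 / 4)"
  proof (intro sum.cong refl)
    fix i j
    have A: "h (A x) z = (h (br \<mu> x y) z + h (br \<mu> z y) x + h (br \<mu> z x) y) / 2 - a * h (D *v x) z"
      for x z
      using nabla_tangent[of x a y z] g_split[of "fst (nabla (0, x) ?Y)" "A x" 0 z]
      by (simp add: A_def)
    have "h (br \<mu> (v i) (v j)) y = - h (br \<mu> (v j) (v i)) y"
      using skew[of "v i" "v j"] hs(4) by simp
    moreover have "h (D *v v j) (v i) = h (D *v v i) (v j)"
      using sym inner_product_sym[OF g, of "(0, v j)" "(0, D *v v i)"] by simp
    ultimately show "h (A (v i)) (v j) * h (A (v j)) (v i) =
        ((h (br \<mu> (v i) y) (v j) + h (br \<mu> (v j) y) (v i)) / 2 - a * h (D *v v i) (v j))\<^sup>2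
        - (h (br \<mu> (v j) (v i)) y)\<^sup>2 / 4"
      unfolding A by (simp add: power2_eq_square field_simps)
  qed
  finally show ?thesis
    unfolding ricci_eq[OF g lc] 1 using fst_nabla[of a y] by (simp add: w)
qed

end

subsection \<open>Diagonal operators and the moment map\<close>

lemma Diag_mult:
  fixes A D :: "'n::finite operator"
  assumes "D \<in> Diag"
  shows "(A ** D) $ p $ q = A $ p $ q * D $ q $ q" and "(D ** A) $ p $ q = D $ p $ p * A $ p $ q"
proof -
  have "(A ** D) $ p $ q = (\<Sum>k\<in>UNIV. if k = q then A $ p $ q * D $ q $ q else 0)"
    unfolding matrix_matrix_mult_def vec_lambda_beta using assms
    by (intro sum.cong refl) (auto simp: Diag_def)
  then show "(A ** D) $ p $ q = A $ p $ q * D $ q $ q" by simp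
  have "(D ** A) $ p $ q = (\<Sum>k\<in>UNIV. if k = p then D $ p $ p * A $ p $ q else 0)"
    unfolding matrix_matrix_mult_def vec_lambda_beta using assms
    by (intro sum.cong refl) (auto simp: Diag_def)
  then show "(D ** A) $ p $ q = D $ p $ p * A $ p $ q" by simp
qed

lemma Diag_mult_vector:
  fixes D :: "'n::finite operator"
  assumes "D \<in> Diag"
  shows "(D *v x) $ p = D $ p $ p * x $ p"
proof -
  have "(D *v x) $ p = (\<Sum>q\<in>UNIV. if q = p then D $ p $ p * x $ p else 0)"
    unfolding matrix_vector_mult_def vec_lambda_beta using assms
    by (intro sum.cong refl) (auto simp: Diag_def)
  then show ?thesis by simp
qed

lemma Diag_axis:
  fixes D :: "'n::finite operator"
  assumes "D \<in> Diag"
  shows "D *v axis p 1 = (D $ p $ p) *\<^sub>R axis p 1"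
  by (simp add: vec_eq_iff Diag_mult_vector[OF assms] axis_def)

lemma Diag_invertible_iff:
  fixes D :: "'n::finite operator"
  assumes D: "D \<in> Diag"
  shows "invertible D \<longleftrightarrow> (\<forall>p. D $ p $ p \<noteq> 0)"
proof
  assume "invertible D"
  then obtain A where "D ** A = mat 1" by (auto simp: invertible_def)
  then have "D $ p $ p * A $ p $ p = 1" for p
    using Diag_mult(2)[OF D, of A p p] by (simp add: mat_def)
  then show "\<forall>p. D $ p $ p \<noteq> 0" by (metis mult_zero_left zero_neq_one)
next
  assume nz: "\<forall>p. D $ p $ p \<noteq> 0"
  let ?A = "(\<chi> p q. if p = q then 1 / D $ p $ p else 0) :: 'n operator"
  have "D ** ?A = mat 1" "?A ** D = mat 1"
    using nz by (simp_all add: vec_eq_iff Diag_mult[OF D] mat_def)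
  then show "invertible D" by (auto simp: invertible_def)
qed

lemma gl_act_Diag:
  fixes g :: "'n::finite operator"
  assumes g: "g \<in> Diag" "invertible g"
  shows "gl_act g \<mu> $ p $ q $ s = g $ s $ s * \<mu> $ p $ q $ s / (g $ p $ p * g $ q $ q)"
proof -
  have nz: "g $ p $ p \<noteq> 0" for p using g by (simp add: Diag_invertible_iff)
  have "g ** matrix_inv g = mat 1"
    using g(2) unfolding invertible_def matrix_inv_def by (metis (mono_tags, lifting) someI_ex)
  then have e: "g $ p $ p * matrix_inv g $ p $ q = (if p = q then 1 else 0)" for p q
    using Diag_mult(2)[OF g(1), of "matrix_inv g" p q] by (simp add: mat_def)
  have d: "matrix_inv g \<in> Diag" using e nz by (auto simp: Diag_def) (metis mult_eq_0_iff)
  have i: "matrix_inv g $ p $ p = 1 / g $ p $ p" for p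
    using e[of p p] nz[of p] by (simp add: field_simps)
  show ?thesis
    by (simp add: gl_act_def Diag_axis[OF d] Diag_mult_vector[OF g(1)] i
        linear_scale[OF linear_br_left] linear_scale[OF linear_br_right])
qed

text \<open>The hypotheses say that any two indices of a nonzero structure constant determine the
  third, as for a nice basis. An off-diagonal entry of \<open>E\<close> multiplies a product of two
  structure constants that differ in exactly one index, and such a product is zero.\<close>

lemma inner_gl_deriv_nice:
  fixes \<nu> :: "'n::finite tensor"
  assumes 1: "\<And>p q s t. \<nu> $ p $ q $ s \<noteq> 0 \<Longrightarrow> \<nu> $ p $ q $ t \<noteq> 0 \<Longrightarrow> t = s"
    and 2: "\<And>p q s a. \<nu> $ p $ q $ s \<noteq> 0 \<Longrightarrow> \<nu> $ a $ q $ s \<noteq> 0 \<Longrightarrow> a = p"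
    and 3: "\<And>p q s a. \<nu> $ p $ q $ s \<noteq> 0 \<Longrightarrow> \<nu> $ p $ a $ s \<noteq> 0 \<Longrightarrow> a = q"
  shows "inner_V (gl_deriv_act E \<nu>) \<nu> = (\<Sum>p\<in>UNIV. \<Sum>q\<in>UNIV. \<Sum>s\<in>UNIV.
    (E $ s $ s - E $ p $ p - E $ q $ q) * (\<nu> $ p $ q $ s)\<^sup>2) / 2"
proof -
  have "gl_deriv_act E \<nu> $ p $ q $ s * \<nu> $ p $ q $ s
      = (E $ s $ s - E $ p $ p - E $ q $ q) * (\<nu> $ p $ q $ s)\<^sup>2" for p q s
  proof -
    have Ea: "E *v axis p 1 = (\<Sum>a\<in>UNIV. E $ a $ p *\<^sub>R axis a 1)" for p
      by (simp add: matrix_vector_mult_basis column_def basis_expansion[of "\<chi> a. E $ a $ p", simplified, symmetric]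
        scalar_mult_eq_scaleR[symmetric])
    have a: "(E *v \<nu> $ p $ q) $ s * \<nu> $ p $ q $ s = E $ s $ s * (\<nu> $ p $ q $ s)\<^sup>2"
    proof -
      have "(E *v \<nu> $ p $ q) $ s * \<nu> $ p $ q $ s
          = (\<Sum>t\<in>UNIV. if t = s then E $ s $ s * (\<nu> $ p $ q $ s)\<^sup>2 else 0)"
        unfolding matrix_vector_mult_def vec_lambda_beta sum_distrib_right using 1[of p q s]
        by (intro sum.cong refl) (auto simp: power2_eq_square)
      then show ?thesis by simp
    qed
    have b: "br \<nu> (E *v axis p 1) (axis q 1) $ s * \<nu> $ p $ q $ s = E $ p $ p * (\<nu> $ p $ q $ s)\<^sup>2"
    proof -
      have "br \<nu> (E *v axis p 1) (axis q 1) $ s * \<nu> $ p $ q $ s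
          = (\<Sum>a\<in>UNIV. E $ a $ p * \<nu> $ a $ q $ s * \<nu> $ p $ q $ s)"
        by (simp add: Ea linear_sum[OF linear_br_left] linear_scale[OF linear_br_left] sum_distrib_right)
      also have "\<dots> = (\<Sum>a\<in>UNIV. if a = p then E $ p $ p * (\<nu> $ p $ q $ s)\<^sup>2 else 0)"
        using 2[of p q s] by (intro sum.cong refl) (auto simp: power2_eq_square)
      finally show ?thesis by simp
    qed
    have c: "br \<nu> (axis p 1) (E *v axis q 1) $ s * \<nu> $ p $ q $ s = E $ q $ q * (\<nu> $ p $ q $ s)\<^sup>2"
    proof -
      have "br \<nu> (axis p 1) (E *v axis q 1) $ s * \<nu> $ p $ q $ s
          = (\<Sum>a\<in>UNIV. E $ a $ q * \<nu> $ p $ a $ s * \<nu> $ p $ q $ s)"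
        by (simp add: Ea linear_sum[OF linear_br_right] linear_scale[OF linear_br_right] sum_distrib_right)
      also have "\<dots> = (\<Sum>a\<in>UNIV. if a = q then E $ q $ q * (\<nu> $ p $ q $ s)\<^sup>2 else 0)"
        using 3[of p q s] by (intro sum.cong refl) (auto simp: power2_eq_square)
      finally show ?thesis by simp
    qed
    show ?thesis
      by (simp add: gl_deriv_act_def left_diff_distrib a b c)
  qed
  then show ?thesis by (simp add: inner_V_eq inner_vec_def)
qed

lemma sum_swap3:
  "(\<Sum>r\<in>A. \<Sum>p\<in>B. \<Sum>q\<in>C. \<Sum>s\<in>D. f r p q s)
    = (\<Sum>p\<in>B. \<Sum>q\<in>C. \<Sum>s\<in>D. \<Sum>r\<in>A. f r p q s)"
proof -
  have "(\<Sum>r\<in>A. \<Sum>p\<in>B. \<Sum>q\<in>C. \<Sum>s\<in>D. f r p q s) = (\<Sum>p\<in>B. \<Sum>r\<in>A. \<Sum>q\<in>C. \<Sum>s\<in>D. f r p q s)"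
    by (rule sum.swap)
  also have "\<dots> = (\<Sum>p\<in>B. \<Sum>q\<in>C. \<Sum>r\<in>A. \<Sum>s\<in>D. f r p q s)"
    by (intro sum.cong refl) (rule sum.swap)
  also have "\<dots> = (\<Sum>p\<in>B. \<Sum>q\<in>C. \<Sum>s\<in>D. \<Sum>r\<in>A. f r p q s)"
    by (intro sum.cong refl) (rule sum.swap)
  finally show ?thesis .
qed

text \<open>The convention \<open>x / 0 = 0\<close> makes the formula hold for \<open>\<nu> = 0\<close> as well.\<close>

lemma moment_map_nice:
  fixes \<nu> :: "'n::finite tensor"
  assumes 1: "\<And>p q s t. \<nu> $ p $ q $ s \<noteq> 0 \<Longrightarrow> \<nu> $ p $ q $ t \<noteq> 0 \<Longrightarrow> t = s"
    and 2: "\<And>p q s a. \<nu> $ p $ q $ s \<noteq> 0 \<Longrightarrow> \<nu> $ a $ q $ s \<noteq> 0 \<Longrightarrow> a = p"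
    and 3: "\<And>p q s a. \<nu> $ p $ q $ s \<noteq> 0 \<Longrightarrow> \<nu> $ p $ a $ s \<noteq> 0 \<Longrightarrow> a = q"
  shows "moment_map \<nu> = (\<chi> r c. if r = c then
    (\<Sum>p\<in>UNIV. \<Sum>q\<in>UNIV. \<Sum>s\<in>UNIV.
      (of_bool (s = r) - of_bool (p = r) - of_bool (q = r)) * (\<nu> $ p $ q $ s)\<^sup>2)
    / (\<Sum>p\<in>UNIV. \<Sum>q\<in>UNIV. \<Sum>s\<in>UNIV. (\<nu> $ p $ q $ s)\<^sup>2) else 0)"
    (is "_ = ?M")
proof (cases "\<nu> = 0")
  case True
  then show ?thesis by (simp add: moment_map_def vec_eq_iff)
next
  case False
  let ?S = "\<lambda>f. \<Sum>p\<in>UNIV. \<Sum>q\<in>UNIV. \<Sum>s\<in>UNIV. f p q s * (\<nu> $ p $ q $ s)\<^sup>2"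
  have n: "inner_V \<nu> \<nu> = (\<Sum>p\<in>UNIV. \<Sum>q\<in>UNIV. \<Sum>s\<in>UNIV. (\<nu> $ p $ q $ s)\<^sup>2) / 2"
    by (simp add: inner_V_eq inner_vec_def power2_eq_square)
  have "?M \<bullet> E = inner_V (gl_deriv_act E \<nu>) \<nu> / inner_V \<nu> \<nu>" for E
  proof -
    have "?M \<bullet> E = (\<Sum>r\<in>UNIV. \<Sum>c\<in>UNIV. if r = c then ?M $ r $ r * E $ r $ r else 0)"
      unfolding inner_vec_def inner_real_def by (intro sum.cong refl) simp
    also have "\<dots> = (\<Sum>r\<in>UNIV. ?M $ r $ r * E $ r $ r)" by simp
    also have "\<dots> = (\<Sum>r\<in>UNIV. ?S (\<lambda>p q s. of_bool (s = r) - of_bool (p = r) - of_bool (q = r)) * E $ r $ r)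
        / (2 * inner_V \<nu> \<nu>)"
      unfolding n by (simp add: sum_divide_distrib[symmetric])
    also have "(\<Sum>r\<in>UNIV. ?S (\<lambda>p q s. of_bool (s = r) - of_bool (p = r) - of_bool (q = r)) * E $ r $ r)
        = (\<Sum>r\<in>UNIV. ?S (\<lambda>p q s. (of_bool (s = r) - of_bool (p = r) - of_bool (q = r)) * E $ r $ r))"
      unfolding sum_distrib_right by (intro sum.cong refl) (simp add: mult_ac)
    also have "\<dots> = (\<Sum>p\<in>UNIV. \<Sum>q\<in>UNIV. \<Sum>s\<in>UNIV. \<Sum>r\<in>UNIV.
        (of_bool (s = r) - of_bool (p = r) - of_bool (q = r)) * E $ r $ r * (\<nu> $ p $ q $ s)\<^sup>2)"
      by (rule sum_swap3)
    also have "\<dots> = ?S (\<lambda>p q s. E $ s $ s - E $ p $ p - E $ q $ q)"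
    proof (intro sum.cong refl)
      fix p q s
      have "(\<Sum>r\<in>UNIV. of_bool (a = r) * E $ r $ r) = E $ a $ a" for a
        by (simp add: of_bool_def if_distrib[where f = "\<lambda>x. x * _"] cong: if_cong)
      then show "(\<Sum>r\<in>UNIV. (of_bool (s = r) - of_bool (p = r) - of_bool (q = r)) * E $ r $ r * (\<nu> $ p $ q $ s)\<^sup>2)
          = (E $ s $ s - E $ p $ p - E $ q $ q) * (\<nu> $ p $ q $ s)\<^sup>2"
        by (simp only: sum_distrib_right[symmetric] left_diff_distrib sum_subtractf)
    qed
    also have "\<dots> = 2 * inner_V (gl_deriv_act E \<nu>) \<nu>"
      by (subst inner_gl_deriv_nice) (use 1 2 3 in \<open>blast | simp\<close>)+
    finally show ?thesis by simp
  qed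
  moreover have "transpose ?M = ?M" by (auto simp: transpose_def vec_eq_iff)
  ultimately have "(THE M. transpose M = M \<and> (\<forall>E. transpose E = E \<longrightarrow>
      M \<bullet> E = inner_V (gl_deriv_act E \<nu>) \<nu> / inner_V \<nu> \<nu>)) = ?M"
    by (intro the1_equality[OF moment_map_unique]) auto
  then show ?thesis using False by (simp add: moment_map_def)
qed

section \<open>Positive diagonal operators in the identity component of the centralizer\<close>

lemma Diag_pos_subset_centralizer:
  fixes t :: "'n::finite operator set"
  assumes "t \<subseteq> Diag"
  shows "Diag_pos \<subseteq> centralizer t"
proof
  fix g :: "'n operator" assume g: "g \<in> Diag_pos"
  have "invertible g" using g by (auto simp: Diag_pos_def Diag_invertible_iff less_le)
  moreover have "g ** D = D ** g" if "D \<in> t" for D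
  proof -
    have "g \<in> Diag" "D \<in> Diag" using g that assms by (auto simp: Diag_pos_def)
    then have "(g ** D) $ p $ q = (D ** g) $ p $ q" for p q
      by (cases "p = q") (auto simp: Diag_mult(1)[of D] Diag_mult(2)[of D], simp_all add: Diag_def)
    then show ?thesis by (simp add: vec_eq_iff)
  qed
  ultimately show "g \<in> centralizer t" by (simp add: centralizer_def)
qed

text \<open>\<open>Diag_pos\<close> is convex, hence connected, and contains the identity.\<close>

lemma Diag_pos_subset_G0:
  fixes t :: "'n::finite operator set"
  assumes "t \<subseteq> Diag"
  shows "Diag_pos \<subseteq> G0 t"
proof
  fix g :: "'n operator" assume g: "g \<in> Diag_pos"
  have "convex (Diag_pos :: 'n operator set)"
  proof (rule convexI)
    fix A B :: "'n operator" and u v :: real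
    assume "A \<in> Diag_pos" "B \<in> Diag_pos" and uv: "0 \<le> u" "0 \<le> v" "u + v = 1"
    moreover have "u * x + v * y > 0" if "x > 0" "y > 0" for x y
    proof (cases "u = 0")
      case False
      then show ?thesis using uv that by (intro add_pos_nonneg) auto
    qed (use uv that in auto)
    ultimately show "u *\<^sub>R A + v *\<^sub>R B \<in> Diag_pos" by (auto simp: Diag_pos_def Diag_def)
  qed
  then have "connected (Diag_pos :: 'n operator set)" by (rule convex_connected)
  moreover have "mat 1 \<in> Diag_pos" by (auto simp: Diag_pos_def Diag_def mat_def)
  ultimately show "g \<in> G0 t"
    unfolding G0_def connected_component_def using g Diag_pos_subset_centralizer[OF assms] by blast
qed

subsection \<open>The cone of the filiform algebra\<close>

text \<open>With tail sums \<open>T j\<close> of \<open>d\<close>, the choice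
  \<open>b j = T (j + 1)\<close> gives equality at every \<open>j \<ge> 3\<close>, since
  \<open>T j - T (j + 1) = d j\<close>. At \<open>j = 2\<close> it leaves the slack
  \<open>T 2\<close>, at \<open>j = 1\<close> the slack \<open>d1 + U\<close>. Both are positive, so
  a small linear correction makes all inequalities strict and keeps \<open>b\<close>
  positive.\<close>

lemma filiform_coefficients:
  fixes n :: nat and d1 d2 :: real and d :: "nat \<Rightarrow> real"
  assumes n: "n > 3" and d: "\<And>i. i \<in> {2..n} \<Longrightarrow> d i = real (i - 2) * d1 + d2" and d1: "d 1 = d1"
    and dn: "d n > 0" and tr: "(\<Sum>i=2..n. d i) > 0"
  obtains b where "\<And>i. i \<in> {2..n-1} \<Longrightarrow> b i > 0"
    and "\<And>j. j \<in> {1..n} \<Longrightarrow> (if 3 \<le> j then b (j - 1) else 0)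
      - (if 2 \<le> j \<and> j \<le> n - 1 then b j else 0)
      - (if j = 1 then \<Sum>i=2..n-1. b i else (0::real)) < d j"
proof -
  have mono: "i \<le> j \<Longrightarrow> d i \<le> d j" if "d1 \<ge> 0" "2 \<le> i" "j \<le> n" for i j
    using d[of i] d[of j] that by (simp add: mult_right_mono)
  have anti: "i \<le> j \<Longrightarrow> d j \<le> d i" if "d1 < 0" "2 \<le> i" "j \<le> n" for i j
    using d[of i] d[of j] that by (simp add: mult_right_mono_neg)
  define T where "T = (\<lambda>j. \<Sum>i=j..n. d i)"
  \<comment> \<open>From index 2 on, \<open>d\<close> is monotone in one direction or the other. If
    \<open>d j > 0\<close>, then \<open>d n > 0\<close> makes the whole tail positive. Otherwise
    \<open>d\<close> increases, the terms before \<open>j\<close> are at most 0, and the tail is at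
    least the full sum.\<close>
  have T_pos: "T j > 0" if j: "2 \<le> j" "j \<le> n" for j
  proof (cases "d j > 0")
    case True
    have "d i > 0" if "i \<in> {j..n}" for i
    proof (cases "d1 \<ge> 0")
      case True
      then show ?thesis using mono[of j i] \<open>d j > 0\<close> j that by auto
    next
      case False
      then show ?thesis using anti[of i n] dn j that by auto
    qed
    then show ?thesis unfolding T_def using j by (intro sum_pos) auto
  next
    case False
    then have "d1 \<ge> 0" using anti[of j n] dn j by fastforce
    then have "d i \<le> 0" if "i \<in> {2..<j}" for i using mono[of i j] False j that by auto
    then have "(\<Sum>i\<in>{2..<j}. d i) \<le> 0" by (intro sum_nonpos)
    moreover have "{2..n} = {2..<j} \<union> {j..n}" using j by auto
    then have "(\<Sum>i=2..n. d i) = (\<Sum>i\<in>{2..<j}. d i) + T j"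
      unfolding T_def by (simp only:) (rule sum.union_disjoint; auto)
    ultimately show ?thesis using tr by simp
  qed
  have T_step: "T j = d j + T (j + 1)" if "j \<le> n" for j
    unfolding T_def using that by (simp add: sum.atLeast_Suc_atMost)
  define U where "U = (\<Sum>j=2..n-1. T (j + 1))"
  \<comment> \<open>For \<open>d1 < 0\<close> all \<open>d i\<close> are positive, and the last two
    summands of \<open>U\<close> suffice: they contain \<open>d (n - 1)\<close>, and
    \<open>d (n - 1) + d1 = d n\<close>. That there are two such summands uses
    \<open>n > 3\<close>.\<close>
  have U: "d1 + U > 0"
  proof (cases "d1 \<ge> 0")
    case True
    have "U > 0" unfolding U_def using n T_pos by (intro sum_pos) auto
    then show ?thesis using True by simp
  next
    case False
    have "d i > 0" if "i \<in> {2..n}" for i using anti[of i n] False dn that by auto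
    then have "0 < d (n - 1)" "0 < T n" using n T_pos by auto
    have "(\<Sum>j\<in>{n-2,n-1}. T (j + 1)) \<le> U"
      unfolding U_def using n T_pos by (intro sum_mono2) (auto simp: less_imp_le)
    then have "T (n - 1) + T n \<le> U" using n by (simp add: numeral_eq_Suc Suc_diff_Suc)
    moreover have "T (n - 1) = d (n - 1) + T n" using T_step[of "n - 1"] n by simp
    moreover have "d n = d (n - 1) + d1"
    proof -
      have "d n = real (n - 2) * d1 + d2" "d (n - 1) = real (n - 1 - 2) * d1 + d2"
        by (rule d; use n in simp)+
      moreover have "real (n - 2) = real (n - 1 - 2) + 1" using n by simp
      ultimately show ?thesis by (simp add: algebra_simps)
    qed
    ultimately show ?thesis using dn \<open>0 < T n\<close> T_def by simp
  qed
  define m where "m = Min (insert (d1 + U) (T ` {2..n}))"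
  have m: "m > 0" "m \<le> d1 + U" "\<And>j. j \<in> {2..n} \<Longrightarrow> m \<le> T j"
    using U T_pos n by (simp_all add: m_def) (simp add: min.coboundedI2)
  \<comment> \<open>\<open>m\<close> bounds all slacks from below, and every multiple of
    \<open>e\<close> that occurs has factor at most \<open>n ^ 2\<close>.\<close>
  define e where "e = m / (2 * real n ^ 2)"
  have e: "e > 0" using m n by (simp add: e_def)
  have en: "e * real n ^ 2 < m" using m n by (simp add: e_def)
  have e_le: "e * x < m" if "x \<le> real n ^ 2" for x
    using mult_left_mono[OF that less_imp_le[OF e]] en by linarith
  have e1: "e * real k < m" if "k \<le> n" for k
  proof (rule e_le)
    have "real k \<le> real n * 1" using that by simp
    also have "\<dots> \<le> real n * real n" using n by (intro mult_left_mono) auto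
    finally show "real k \<le> real n ^ 2" by (simp add: power2_eq_square)
  qed
  \<comment> \<open>The correction grows by \<open>e\<close> with each step down from
    \<open>n\<close>, so \<open>b (j - 1) - b j\<close> falls short of \<open>d j\<close> by exactly
    \<open>e\<close>.\<close>
  define b where "b = (\<lambda>j. T (j + 1) - e * real (n - j))"
  have b_pos: "b i > 0" if "i \<in> {2..n-1}" for i
  proof -
    have "m \<le> T (i + 1)" using that n by (intro m) auto
    then show ?thesis using e1[of "n - i"] by (simp add: b_def)
  qed
  have sum_b: "- (\<Sum>i=2..n-1. b i) < d1"
  proof -
    have "(\<Sum>i=2..n-1. real (n - i)) \<le> (\<Sum>i=2..n-1. real n)" by (intro sum_mono) auto
    also have "\<dots> \<le> real n ^ 2" by (simp add: power2_eq_square mult_right_mono)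
    finally have "e * (\<Sum>i=2..n-1. real (n - i)) < m" by (rule e_le)
    then show ?thesis
      using m(2) by (simp add: b_def sum_subtractf U_def sum_distrib_left)
  qed
  show ?thesis
  proof (rule that[of b])
    fix j assume j: "j \<in> {1..n}"
    consider "j = 1" | "j = 2" | "3 \<le> j" "j \<le> n - 1" | "j = n" "j \<noteq> 1" "j \<noteq> 2" "3 \<le> j" using j n by fastforce
    then show "(if 3 \<le> j then b (j - 1) else 0) - (if 2 \<le> j \<and> j \<le> n - 1 then b j else 0)
      - (if j = 1 then \<Sum>i=2..n-1. b i else (0::real)) < d j"
    proof cases
      case 1
      then show ?thesis using sum_b d1 by simp
    next
      case 2
      have "2 \<le> n - Suc 0" using n by linarith
      moreover have "e * real (n - 2) < T 2" using e1[of "n - 2"] m(3)[of 2] n by auto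
      ultimately show ?thesis using 2 n T_step[of 2] by (simp add: b_def)
    next
      case 3
      have "real (n - (j - 1)) = real (n - j) + 1" using 3 by (simp add: of_nat_diff)
      then have "b (j - 1) - b j = d j - e"
        using T_step[of j] 3 n by (simp add: b_def algebra_simps)
      then show ?thesis using 3 e n by simp
    next
      case 4
      have "T n = d n" by (simp add: T_def)
      moreover have "b (n - 1) = T n - e" using n by (simp add: b_def)
      moreover have "\<not> n \<le> n - Suc 0" using n by linarith
      ultimately show ?thesis using 4 e n by simp
    qed
  qed (use b_pos in auto)
qed

text \<open>Prescribes the successive ratios from index 2 on. The product is empty up to index 2, so
  \<open>\<gamma> 1 = \<gamma> 2 = 1\<close> and \<open>e_1\<close> is not rescaled. It serves both
  for a diagonal change of basis and for the weights of a diagonal metric.\<close>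

lemma recursive_product:
  fixes c :: "nat \<Rightarrow> real"
  assumes "\<And>i. c i > 0"
  obtains \<gamma> where "\<And>i. \<gamma> i > (0::real)" "\<gamma> 1 = 1" "\<And>i. 2 \<le> i \<Longrightarrow> \<gamma> (i + 1) = c i * \<gamma> i"
proof (rule that[of "\<lambda>i. \<Prod>k\<in>{2..<i}. c k"])
  show "(\<Prod>k\<in>{2..<i}. c k) > 0" for i using assms by (intro prod_pos) auto
qed (simp_all add: mult.commute)

section \<open>Tensors supported on the brackets of the filiform algebra\<close>

definition filiform_support :: "nat \<Rightarrow> (nat \<Rightarrow> 'n) \<Rightarrow> 'n \<Rightarrow> 'n \<Rightarrow> 'n \<Rightarrow> bool" where
  "filiform_support n l p q s \<longleftrightarrow> (\<exists>i\<in>{2..n-1}. s = l (i + 1)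
     \<and> (p = l 1 \<and> q = l i \<or> p = l i \<and> q = l 1))"

text \<open>A closed linear condition preserved by invertible diagonal operators. It passes from
  \<open>filiform n l\<close> to the whole orbit closure, including limits in which some brackets
  become zero.\<close>

definition supported :: "nat \<Rightarrow> (nat \<Rightarrow> 'n::finite) \<Rightarrow> 'n tensor set" where
  "supported n l = {\<nu>. \<forall>p q s. \<not> filiform_support n l p q s \<longrightarrow> \<nu> $ p $ q $ s = 0}"

lemma closed_supported: "closed (supported n l)"
  unfolding supported_def
  by (intro closed_Collect_all closed_Collect_imp open_Collect_const closed_Collect_eq
      continuous_intros)

lemma filiform_supported: "filiform n l \<in> supported n l"
proof -
  have "filiform n l $ p $ q $ s = 0" if "\<not> filiform_support n l p q s" for p q s
    unfolding filiform_def vec_lambda_beta sum_component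
    using that by (intro sum.neutral ballI) (auto simp: filiform_support_def axis_def)
  then show ?thesis by (simp add: supported_def)
qed

context
  fixes n :: nat and l :: "nat \<Rightarrow> 'n::finite"
  assumes n: "3 < n" and l: "bij_betw l {1..n} UNIV"
begin

private lemmas l_inj = l_eq_iff[OF l]

lemma sum_UNIV_l: "(\<Sum>p\<in>UNIV. f p) = (\<Sum>i=1..n. f (l i))"
  by (rule sum.reindex_bij_betw[OF l, symmetric])

lemma support_inj: "i \<in> {2..n-1} \<Longrightarrow> j \<in> {2..n-1} \<Longrightarrow> l i = l j \<longleftrightarrow> i = j"
  "i \<in> {2..n-1} \<Longrightarrow> j \<in> {2..n-1} \<Longrightarrow> l (i + 1) = l (j + 1) \<longleftrightarrow> i = j"
  "i \<in> {2..n-1} \<Longrightarrow> l i \<noteq> l 1" "i \<in> {2..n-1} \<Longrightarrow> l 1 \<noteq> l i"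
  "i \<in> {2..n-1} \<Longrightarrow> l (i + 1) \<noteq> l 1"
proof -
  have r: "a \<in> {1..n}" "a + 1 \<in> {1..n}" "1 \<in> {1..n}" "a \<noteq> 1" "a + 1 \<noteq> 1" if "a \<in> {2..n-1}" for a
    using that by auto
  show "i \<in> {2..n-1} \<Longrightarrow> j \<in> {2..n-1} \<Longrightarrow> l i = l j \<longleftrightarrow> i = j"
    by (rule l_inj[OF r(1) r(1)])
  show "i \<in> {2..n-1} \<Longrightarrow> j \<in> {2..n-1} \<Longrightarrow> l (i + 1) = l (j + 1) \<longleftrightarrow> i = j"
    using l_inj[OF r(2) r(2)] by simp
  show "i \<in> {2..n-1} \<Longrightarrow> l i \<noteq> l 1" "i \<in> {2..n-1} \<Longrightarrow> l 1 \<noteq> l i"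
    "i \<in> {2..n-1} \<Longrightarrow> l (i + 1) \<noteq> l 1"
    using l_inj[OF r(1) r(3)] l_inj[OF r(2) r(3)] r(4,5) by metis+
qed

text \<open>On the support \<open>s = l (i + 1)\<close> determines \<open>i\<close>, and of the
  other two indices exactly one is \<open>l 1\<close>. So any two indices determine the
  third.\<close>

lemma supported_nice:
  assumes "\<nu> \<in> supported n l"
  shows "\<nu> $ p $ q $ s \<noteq> 0 \<Longrightarrow> \<nu> $ p $ q $ t \<noteq> 0 \<Longrightarrow> t = s"
    and "\<nu> $ p $ q $ s \<noteq> 0 \<Longrightarrow> \<nu> $ a $ q $ s \<noteq> 0 \<Longrightarrow> a = p"
    and "\<nu> $ p $ q $ s \<noteq> 0 \<Longrightarrow> \<nu> $ p $ a $ s \<noteq> 0 \<Longrightarrow> a = q"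
proof -
  have s: "filiform_support n l p q s" if "\<nu> $ p $ q $ s \<noteq> 0" for p q s
    using assms that unfolding supported_def by blast
  have "t = s" if "filiform_support n l p q s" "filiform_support n l p q t"
    using that support_inj unfolding filiform_support_def by metis
  then show "\<nu> $ p $ q $ s \<noteq> 0 \<Longrightarrow> \<nu> $ p $ q $ t \<noteq> 0 \<Longrightarrow> t = s" using s by blast
  have "a = p" if "filiform_support n l p q s" "filiform_support n l a q s"
    using that support_inj unfolding filiform_support_def by metis
  then show "\<nu> $ p $ q $ s \<noteq> 0 \<Longrightarrow> \<nu> $ a $ q $ s \<noteq> 0 \<Longrightarrow> a = p" using s by blast
  have "a = q" if "filiform_support n l p q s" "filiform_support n l p a s"
    using that support_inj unfolding filiform_support_def by metis
  then show "\<nu> $ p $ q $ s \<noteq> 0 \<Longrightarrow> \<nu> $ p $ a $ s \<noteq> 0 \<Longrightarrow> a = q" using s by blast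
qed

text \<open>The support is the disjoint union of two families of triples, one for each order of the
  arguments of the bracket.\<close>

lemma sum_support:
  fixes \<phi> :: "'n \<Rightarrow> 'n \<Rightarrow> 'n \<Rightarrow> real"
  assumes "\<And>p q s. \<not> filiform_support n l p q s \<Longrightarrow> \<phi> p q s = 0"
  shows "(\<Sum>p\<in>UNIV. \<Sum>q\<in>UNIV. \<Sum>s\<in>UNIV. \<phi> p q s)
    = (\<Sum>i=2..n-1. \<phi> (l 1) (l i) (l (i + 1)) + \<phi> (l i) (l 1) (l (i + 1)))"
proof -
  let ?A = "(\<lambda>i. (l 1, l i, l (i + 1))) ` {2..n-1}" and ?B = "(\<lambda>i. (l i, l 1, l (i + 1))) ` {2..n-1}"
  have "(\<Sum>p\<in>UNIV. \<Sum>q\<in>UNIV. \<Sum>s\<in>UNIV. \<phi> p q s) = (\<Sum>(p, q, s)\<in>UNIV. \<phi> p q s)"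
    by (simp add: sum.cartesian_product UNIV_Times_UNIV[symmetric] del: UNIV_Times_UNIV)
  also have "\<dots> = (\<Sum>(p, q, s)\<in>?A \<union> ?B. \<phi> p q s)"
  proof (rule sum.mono_neutral_right)
    have "(p, q, s) \<in> ?A \<union> ?B" if "filiform_support n l p q s" for p q s
      using that unfolding filiform_support_def by blast
    then show "\<forall>x\<in>UNIV - (?A \<union> ?B). (case x of (p, q, s) \<Rightarrow> \<phi> p q s) = 0"
      using assms by fast
  qed auto
  also have "\<dots> = (\<Sum>(p, q, s)\<in>?A. \<phi> p q s) + (\<Sum>(p, q, s)\<in>?B. \<phi> p q s)"
    using support_inj(3,4) by (intro sum.union_disjoint) auto
  also have "(\<Sum>(p, q, s)\<in>?A. \<phi> p q s) = (\<Sum>i=2..n-1. \<phi> (l 1) (l i) (l (i + 1)))"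
    using support_inj(1) by (subst sum.reindex) (auto simp: inj_on_def)
  also have "(\<Sum>(p, q, s)\<in>?B. \<phi> p q s) = (\<Sum>i=2..n-1. \<phi> (l i) (l 1) (l (i + 1)))"
    using support_inj(1) by (subst sum.reindex) (auto simp: inj_on_def)
  finally show ?thesis by (simp add: sum.distrib)
qed

lemma filiform_torus_subset_Diag: "filiform_torus n l \<subseteq> Diag"
  by (auto simp: filiform_torus_def)

text \<open>The torus contains an element with pairwise distinct diagonal entries:
  \<open>d1 = 1\<close> and \<open>d2 = n\<close> give \<open>1, n, n + 1, ..., 2 n - 2\<close>.
  Whatever commutes with it is diagonal.\<close>

lemma centralizer_torus_subset_Diag: "centralizer (filiform_torus n l) \<subseteq> Diag"
proof
  fix A assume A: "A \<in> centralizer (filiform_torus n l)"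
  define m where "m = inv_into {1..n} l"
  have m: "m (l i) = i" if "i \<in> {1..n}" for i
    using l that by (simp add: m_def bij_betw_inv_into_left)
  define D0 :: "'n operator" where
    "D0 = (\<chi> p q. if p = q then (if m p = 1 then 1 else real (m p - 2) + real n) else 0)"
  have D0_Diag: "D0 \<in> Diag" by (simp add: D0_def Diag_def)
  have "D0 \<in> filiform_torus n l"
    using n D0_Diag by (auto simp: filiform_torus_def D0_def m intro!: exI[of _ "real n"])
  then have c: "A ** D0 = D0 ** A" using A by (auto simp: centralizer_def)
  have dist: "D0 $ p $ p \<noteq> D0 $ q $ q" if "p \<noteq> q" for p q
  proof -
    obtain i j where "i \<in> {1..n}" "p = l i" "j \<in> {1..n}" "q = l j"
      using l_cases[OF l] by metis
    then show ?thesis using that n by (auto simp: D0_def m of_nat_diff split: if_splits)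
  qed
  have "A $ p $ q = 0" if "p \<noteq> q" for p q
  proof -
    have "A $ p $ q * D0 $ q $ q = D0 $ p $ p * A $ p $ q"
      using c Diag_mult[OF D0_Diag] by metis
    then show ?thesis using dist[OF that] by (auto simp: mult.commute)
  qed
  then show "A \<in> Diag" by (simp add: Diag_def)
qed

text \<open>Elements of \<open>G0\<close> are diagonal, so they only rescale structure constants.
  The closed set \<open>supported n l\<close> thus contains the orbit and its closure.\<close>

lemma closure_orbit_supported:
  "closure ((\<lambda>g. gl_act g (filiform n l)) ` G0 (filiform_torus n l)) \<subseteq> supported n l"
proof (rule closure_minimal[OF _ closed_supported], rule image_subsetI)
  fix g assume "g \<in> G0 (filiform_torus n l)"
  then have "g \<in> centralizer (filiform_torus n l)"
    using connected_component_subset unfolding G0_def by blast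
  then have "g \<in> Diag" "invertible g"
    using centralizer_torus_subset_Diag by (auto simp: centralizer_def)
  then show "gl_act g (filiform n l) \<in> supported n l"
    using filiform_supported[of n l] by (simp add: supported_def gl_act_Diag)
qed

lemma moment_map_supported:
  assumes "\<nu> \<in> supported n l"
  shows "moment_map \<nu> = (\<chi> r c. if r = c then
    (\<Sum>p\<in>UNIV. \<Sum>q\<in>UNIV. \<Sum>s\<in>UNIV.
      (of_bool (s = r) - of_bool (p = r) - of_bool (q = r)) * (\<nu> $ p $ q $ s)\<^sup>2)
    / (\<Sum>p\<in>UNIV. \<Sum>q\<in>UNIV. \<Sum>s\<in>UNIV. (\<nu> $ p $ q $ s)\<^sup>2) else 0)"
  using supported_nice[OF assms] by (rule moment_map_nice)

lemma trace_eq_sum_l: "D \<in> Diag \<Longrightarrow> trace D = D $ l 1 $ l 1 + (\<Sum>i=2..n. D $ l i $ l i)"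
  using n by (simp add: trace_def sum_UNIV_l sum.atLeast_Suc_atMost[of "Suc 0" n] numeral_2_eq_2)

text \<open>Since \<open>E\<close> is positive, it is enough that the moment map is nonnegative at
  \<open>l n\<close> and has sum zero over \<open>l 2, ..., l n\<close>. The first holds because
  \<open>l n\<close> is never an argument of a bracket on the support. For the second, each triple
  counts \<open>+1\<close> at \<open>l (i + 1)\<close> and \<open>-1\<close> at \<open>l i\<close>,
  while \<open>l 1\<close> is outside the sum.\<close>

lemma cone_C_positive:
  assumes "D \<in> cone_C (filiform n l) (filiform_torus n l)"
  shows "D $ l n $ l n > 0" and "(\<Sum>i=2..n. D $ l i $ l i) > 0"
proof -
  obtain r \<nu> E where r: "r > 0" and nu: "\<nu> \<in> supported n l" and E: "E \<in> Diag_pos"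
    and D: "D = r *\<^sub>R moment_map \<nu> + E"
    using assms closure_orbit_supported unfolding cone_C_def by blast
  define w where "w = (\<lambda>r p q s. (of_bool (s = r) - of_bool (p = r) - of_bool (q = r)) * (\<nu> $ p $ q $ s)\<^sup>2)"
  define Q where "Q = (\<Sum>p\<in>UNIV. \<Sum>q\<in>UNIV. \<Sum>s\<in>UNIV. (\<nu> $ p $ q $ s)\<^sup>2)"
  have Q: "Q \<ge> 0" unfolding Q_def by (intro sum_nonneg) simp
  have M: "moment_map \<nu> $ a $ a = (\<Sum>p\<in>UNIV. \<Sum>q\<in>UNIV. \<Sum>s\<in>UNIV. w a p q s) / Q" for a
    by (simp add: moment_map_supported[OF nu] w_def Q_def)
  have w0: "w a p q s = 0" if "\<not> filiform_support n l p q s" for a p q s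
    using nu that by (simp add: w_def supported_def)
  have M': "moment_map \<nu> $ a $ a = (\<Sum>i=2..n-1. w a (l 1) (l i) (l (i + 1)) + w a (l i) (l 1) (l (i + 1))) / Q" for a
    unfolding M by (subst sum_support) (auto intro: w0)
  have "l i \<noteq> l n" if "i \<in> {2..n-1}" for i
  proof -
    have "i \<in> {1..n}" "n \<in> {1..n}" "i \<noteq> n" using that n by auto
    then show ?thesis using l_inj by simp
  qed
  moreover have "l 1 \<noteq> l n" using l_inj[of 1 n] n by auto
  ultimately have "moment_map \<nu> $ l n $ l n \<ge> 0"
    unfolding M' using Q by (intro divide_nonneg_nonneg sum_nonneg) (auto simp: w_def)
  then show "D $ l n $ l n > 0"
    using r E unfolding D by (simp add: Diag_pos_def add_nonneg_pos)
  have "(\<Sum>a=2..n. w (l a) (l 1) (l i) (l (i + 1)) + w (l a) (l i) (l 1) (l (i + 1))) = 0"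
    if i: "i \<in> {2..n-1}" for i
  proof -
    have eq: "l b = l a \<longleftrightarrow> b = a" if "a \<in> {2..n}" "b \<in> {1..n}" for a b
      using l_inj[of b a] that by auto
    have d: "(\<Sum>a=2..n. of_bool (l b = l a)) = (if b = 1 then 0 else 1::real)" if "b \<in> {1..n}" for b
    proof -
      have "(\<Sum>a=2..n. of_bool (l b = l a)) = (\<Sum>a=2..n. if a = b then 1 else 0::real)"
        using eq that by (intro sum.cong refl) auto
      then show ?thesis using that by auto
    qed
    have "1 \<in> {1..n}" "i \<in> {1..n}" "i + 1 \<in> {1..n}" "i \<noteq> 1" "i + 1 \<noteq> 1" using i by auto
    then have "(\<Sum>a=2..n. of_bool (l 1 = l a)) = (0::real)" "(\<Sum>a=2..n. of_bool (l i = l a)) = (1::real)"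
      "(\<Sum>a=2..n. of_bool (l (i + 1) = l a)) = (1::real)"
      using d by (simp_all only: simp_thms if_True if_False)
    then show ?thesis
      unfolding w_def sum.distrib sum_distrib_right[symmetric] sum_subtractf by simp
  qed
  then have "(\<Sum>a=2..n. moment_map \<nu> $ l a $ l a) = 0"
    unfolding M' sum_divide_distrib[symmetric] by (subst sum.swap) simp
  moreover have "(\<Sum>a=2..n. E $ l a $ l a) > 0"
    using E n by (intro sum_pos) (auto simp: Diag_pos_def)
  ultimately show "(\<Sum>i=2..n. D $ l i $ l i) > 0"
    unfolding D by (simp add: sum.distrib sum_distrib_left[symmetric])
qed

lemma filiform_nth:
  assumes "i \<in> {2..n-1}"
  shows "filiform n l $ l 1 $ l i $ l (i + 1) = 1" "filiform n l $ l i $ l 1 $ l (i + 1) = -1"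
proof -
  have i: "1 \<in> {1..n}" "i \<in> {1..n}" "2 \<le> i" "i \<le> n - 1" "i \<noteq> 1" using assms by auto
  show "filiform n l $ l 1 $ l i $ l (i + 1) = 1" "filiform n l $ l i $ l 1 $ l (i + 1) = -1"
    using filiform_brackets[OF l i(1,2)] filiform_brackets[OF l i(2,1)] i(3-5)
    by (simp_all add: axis_nth)
qed

text \<open>A positive diagonal \<open>g\<close> moves the bracket to \<open>\<nu>\<close> with
  squared structure constants \<open>b i\<close>. With \<open>B\<close> their sum, \<open>B\<close>
  times the moment map of \<open>\<nu>\<close> has exactly the entries on the left of
  \<open>b_D\<close>, so \<open>r = B\<close> leaves a positive remainder \<open>E\<close>.\<close>

lemma in_cone_C:
  assumes D: "D \<in> filiform_torus n l" and tr: "trace D > 0"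
    and b: "\<And>i. i \<in> {2..n-1} \<Longrightarrow> b i > 0"
    and b_D: "\<And>j. j \<in> {1..n} \<Longrightarrow> (if 3 \<le> j then b (j - 1) else 0)
      - (if 2 \<le> j \<and> j \<le> n - 1 then b j else 0)
      - (if j = 1 then \<Sum>i=2..n-1. b i else (0::real)) < D $ l j $ l j"
  shows "D \<in> cone_C (filiform n l) (filiform_torus n l)"
proof -
  \<comment> \<open>As \<open>g\<close> fixes \<open>e_1\<close>, the structure constants of
    \<open>\<nu>\<close> are the ratios \<open>\<gamma> (i + 1) / \<gamma> i\<close>. The value 1
    outside the range keeps \<open>c\<close> positive everywhere, as
    \<open>recursive_product\<close> requires.\<close>
  define c where "c = (\<lambda>i. if i \<in> {2..n-1} then sqrt (b i) else 1)"
  have "c i > 0" for i using b[of i] by (simp add: c_def)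
  then obtain \<gamma> where \<gamma>: "\<And>i. \<gamma> i > (0::real)" "\<gamma> 1 = 1"
    "\<And>i. 2 \<le> i \<Longrightarrow> \<gamma> (i + 1) = c i * \<gamma> i"
    using recursive_product[of c] by blast
  define m where "m = inv_into {1..n} l"
  have m: "m (l i) = i" if "i \<in> {1..n}" for i
    using l that by (simp add: m_def bij_betw_inv_into_left)
  define g :: "'n operator" where "g = (\<chi> p q. if p = q then \<gamma> (m p) else 0)"
  have g: "g \<in> Diag_pos" using \<gamma>(1) by (auto simp: g_def Diag_pos_def Diag_def)
  then have g': "g \<in> Diag" "invertible g" by (auto simp: Diag_pos_def Diag_invertible_iff less_le)
  define \<nu> where "\<nu> = gl_act g (filiform n l)"
  have gG: "g \<in> G0 (filiform_torus n l)" using Diag_pos_subset_G0[OF filiform_torus_subset_Diag] g by blast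
  have cl: "\<nu> \<in> closure ((\<lambda>g. gl_act g (filiform n l)) ` G0 (filiform_torus n l))"
    unfolding \<nu>_def by (rule subsetD[OF closure_subset], rule imageI, rule gG)
  then have nu: "\<nu> \<in> supported n l" using closure_orbit_supported by blast
  have sq: "(\<nu> $ l 1 $ l i $ l (i + 1))\<^sup>2 = b i" "(\<nu> $ l i $ l 1 $ l (i + 1))\<^sup>2 = b i"
    if i: "i \<in> {2..n-1}" for i
  proof -
    have gl: "g $ l j $ l j = \<gamma> j" if "j \<in> {1..n}" for j using that by (simp add: g_def m)
    have r: "1 \<in> {1..n}" "i \<in> {1..n}" "i + 1 \<in> {1..n}" using i by auto
    have e: "\<gamma> (i + 1) / \<gamma> i = sqrt (b i)" "0 \<le> b i"
      using \<gamma>(1)[of i] \<gamma>(3)[of i] b[OF i] i by (auto simp: c_def field_simps)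
    then show "(\<nu> $ l 1 $ l i $ l (i + 1))\<^sup>2 = b i" "(\<nu> $ l i $ l 1 $ l (i + 1))\<^sup>2 = b i"
      using gl[OF r(1)] gl[OF r(2)] gl[OF r(3)] \<gamma>(2) filiform_nth[OF i]
      by (simp_all add: \<nu>_def gl_act_Diag[OF g'] del: One_nat_def)
  qed
  define B where "B = (\<Sum>i=2..n-1. b i)"
  have B: "B > 0" unfolding B_def using b n by (intro sum_pos) auto
  define w where "w = (\<lambda>r p q s. (of_bool (s = r) - of_bool (p = r) - of_bool (q = r)) * (\<nu> $ p $ q $ s)\<^sup>2)"
  have nu0: "\<nu> $ p $ q $ s = 0" if "\<not> filiform_support n l p q s" for p q s
    using nu that by (simp add: supported_def)
  \<comment> \<open>Each bracket is counted in both argument orders. The same factor 2 appears in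
    \<open>W\<close> and cancels in the moment map.\<close>
  have Q: "(\<Sum>p\<in>UNIV. \<Sum>q\<in>UNIV. \<Sum>s\<in>UNIV. (\<nu> $ p $ q $ s)\<^sup>2) = 2 * B"
  proof -
    have "(\<Sum>p\<in>UNIV. \<Sum>q\<in>UNIV. \<Sum>s\<in>UNIV. (\<nu> $ p $ q $ s)\<^sup>2)
        = (\<Sum>i=2..n-1. (\<nu> $ l 1 $ l i $ l (i + 1))\<^sup>2 + (\<nu> $ l i $ l 1 $ l (i + 1))\<^sup>2)"
      by (rule sum_support) (simp add: nu0)
    also have "\<dots> = (\<Sum>i=2..n-1. 2 * b i)"
      by (intro sum.cong refl) (simp only: sq mult_2)
    finally show ?thesis by (simp add: B_def sum_distrib_left)
  qed
  have W: "(\<Sum>p\<in>UNIV. \<Sum>q\<in>UNIV. \<Sum>s\<in>UNIV. w (l j) p q s)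
      = 2 * ((if 3 \<le> j then b (j - 1) else 0) - (if 2 \<le> j \<and> j \<le> n - 1 then b j else 0)
        - (if j = 1 then B else 0))" if j: "j \<in> {1..n}" for j
  proof -
    have "(\<Sum>p\<in>UNIV. \<Sum>q\<in>UNIV. \<Sum>s\<in>UNIV. w (l j) p q s)
        = (\<Sum>i=2..n-1. w (l j) (l 1) (l i) (l (i + 1)) + w (l j) (l i) (l 1) (l (i + 1)))"
      by (rule sum_support) (simp add: w_def nu0)
    also have "\<dots> = (\<Sum>i=2..n-1. 2 * ((if i = j - 1 then b i else 0) - (if i = j then b i else 0)
        - (if j = 1 then b i else 0)))"
    proof (intro sum.cong refl)
      fix i assume i: "i \<in> {2..n-1}"
      have "l (i + 1) = l j \<longleftrightarrow> i = j - 1" "l i = l j \<longleftrightarrow> i = j" "l 1 = l j \<longleftrightarrow> j = 1"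
      proof -
        have "1 \<in> {1..n}" "i \<in> {1..n}" "i + 1 \<in> {1..n}" using i by auto
        then show "l (i + 1) = l j \<longleftrightarrow> i = j - 1" "l i = l j \<longleftrightarrow> i = j" "l 1 = l j \<longleftrightarrow> j = 1"
          using l_inj[OF _ j] j by (simp_all only: eq_diff_iff) auto
      qed
      then show "w (l j) (l 1) (l i) (l (i + 1)) + w (l j) (l i) (l 1) (l (i + 1))
          = 2 * ((if i = j - 1 then b i else 0) - (if i = j then b i else 0) - (if j = 1 then b i else 0))"
        unfolding w_def sq[OF i] by auto
    qed
    also have "\<dots> = 2 * ((if j - 1 \<in> {2..n-1} then b (j - 1) else 0) - (if j \<in> {2..n-1} then b j else 0)
        - (if j = 1 then B else 0))"
    proof -
      have "(\<Sum>i=2..n-1. if j = 1 then b i else 0) = (if j = 1 then B else 0)"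
        by (simp add: B_def)
      then show ?thesis
        by (simp only: sum_distrib_left[symmetric] sum_subtractf sum.delta finite_atLeastAtMost)
    qed
    also have "j - 1 \<in> {2..n-1} \<longleftrightarrow> 3 \<le> j" using j by auto
    finally show ?thesis by simp
  qed
  have M: "moment_map \<nu> = (\<chi> r c. if r = c then (\<Sum>p\<in>UNIV. \<Sum>q\<in>UNIV. \<Sum>s\<in>UNIV. w r p q s) / (2 * B) else 0)"
    unfolding moment_map_supported[OF nu] Q w_def ..
  have M_Diag: "moment_map \<nu> \<in> Diag" by (simp add: M Diag_def)
  define E where "E = D - B *\<^sub>R moment_map \<nu>"
  have "D \<in> Diag" using D filiform_torus_subset_Diag by blast
  have "E $ p $ p > 0" for p
  proof -
    obtain j where j: "j \<in> {1..n}" "p = l j" using l_cases[OF l] by metis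
    have "B * ((2 * x) / (2 * B)) = x" for x using B by simp
    moreover have "E $ p $ p = D $ l j $ l j
        - B * ((\<Sum>p\<in>UNIV. \<Sum>q\<in>UNIV. \<Sum>s\<in>UNIV. w (l j) p q s) / (2 * B))"
      by (simp add: E_def M j(2))
    ultimately show ?thesis
      using b_D[OF j(1)] unfolding B_def[symmetric] by (simp only: W[OF j(1)] diff_gt_0_iff_gt)
  qed
  then have "E \<in> Diag_pos" using \<open>D \<in> Diag\<close> M_Diag by (simp add: E_def Diag_pos_def Diag_def)
  moreover have "D = B *\<^sub>R moment_map \<nu> + E" by (simp add: E_def)
  ultimately show ?thesis
    unfolding cone_C_def using D tr B cl M_Diag by blast
qed

end

subsection \<open>Ricci negative metrics on the filiform algebra\<close>

lemma sum_pred_interval: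
  fixes f :: "nat \<Rightarrow> real"
  shows "(\<Sum>j=1..n. if 3 \<le> j then f (j - 1) else 0) = (\<Sum>i=2..n-1. f i)"
proof -
  have "(\<Sum>j=1..n. if 3 \<le> j then f (j - 1) else 0) = (\<Sum>j\<in>{j\<in>{1..n}. 3 \<le> j}. f (j - 1))"
    by (rule sum.inter_filter[symmetric]) simp
  also have "\<dots> = (\<Sum>i=2..n-1. f i)"
    by (intro sum.reindex_bij_witness[of _ "\<lambda>i. i + 1" "\<lambda>j. j - 1"]) auto
  finally show ?thesis .
qed

lemma sum_inner_interval:
  fixes f :: "nat \<Rightarrow> real"
  shows "(\<Sum>j=1..n. if 2 \<le> j \<and> j \<le> n - 1 then f j else 0) = (\<Sum>i=2..n-1. f i)"
proof -
  have "(\<Sum>j=1..n. if 2 \<le> j \<and> j \<le> n - 1 then f j else 0) = (\<Sum>j\<in>{j\<in>{1..n}. 2 \<le> j \<and> j \<le> n - 1}. f j)"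
    by (rule sum.inter_filter[symmetric]) simp
  also have "{j\<in>{1..n}. 2 \<le> j \<and> j \<le> n - 1} = {2..n-1}" by auto
  finally show ?thesis .
qed

context
  fixes n :: nat and l :: "nat \<Rightarrow> 'n::finite"
  assumes n: "3 < n" and l: "bij_betw l {1..n} UNIV"
begin

section \<open>Coordinates of the filiform bracket\<close>

lemma vec_eq_l: "x = y \<longleftrightarrow> (\<forall>j\<in>{1..n}. x $ l j = y $ l j)" for x y :: "'a ^ 'n"
  unfolding vec_eq_iff using l_cases[OF l] by metis

lemma axis_l_nth:
  "i \<in> {1..n} \<Longrightarrow> j \<in> {1..n} \<Longrightarrow> axis (l i) x $ l j = (if i = j then x else 0)"
  using l_eq_iff[OF l, of i j] by (auto simp: axis_def)

text \<open>The vector \<open>e_j\<close> arises only from the bracket of \<open>e_1\<close> with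
  \<open>e_(j-1)\<close>, and only for \<open>j \<ge> 3\<close>.\<close>

lemma br_filiform_nth:
  assumes j: "j \<in> {1..n}"
  shows "br (filiform n l) x y $ l j = (if 3 \<le> j then x $ l 1 * y $ l (j - 1) - x $ l (j - 1) * y $ l 1 else 0)"
proof -
  let ?\<phi> = "\<lambda>p q s. if s = l j then x $ p * y $ q * (filiform n l) $ p $ q $ s else 0"
  have "br (filiform n l) x y $ l j = (\<Sum>p\<in>UNIV. \<Sum>q\<in>UNIV. \<Sum>s\<in>UNIV. ?\<phi> p q s)"
    by (simp add: br_def)
  also have "\<dots> = (\<Sum>i=2..n-1. ?\<phi> (l 1) (l i) (l (i + 1)) + ?\<phi> (l i) (l 1) (l (i + 1)))"
  proof (rule sum_support[OF n l])
    fix p q s assume "\<not> filiform_support n l p q s"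
    then have "(filiform n l) $ p $ q $ s = 0" using filiform_supported[of n l] by (simp add: supported_def)
    then show "?\<phi> p q s = 0" by auto
  qed
  also have "\<dots> = (\<Sum>i=2..n-1. if i = j - 1 then x $ l 1 * y $ l i - x $ l i * y $ l 1 else 0)"
  proof (intro sum.cong refl)
    fix i assume i: "i \<in> {2..n-1}"
    then have "i + 1 \<in> {1..n}" by auto
    then have "l (i + 1) = l j \<longleftrightarrow> i = j - 1" using l_eq_iff[OF l _ j] j i by auto
    then show "?\<phi> (l 1) (l i) (l (i + 1)) + ?\<phi> (l i) (l 1) (l (i + 1))
        = (if i = j - 1 then x $ l 1 * y $ l i - x $ l i * y $ l 1 else 0)"
    proof (cases "i = j - 1")
      case True
      then show ?thesis
        using filiform_nth[OF n l i] \<open>l (i + 1) = l j \<longleftrightarrow> i = j - 1\<close>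
        by (simp add: True[symmetric] del: One_nat_def)
    qed simp
  qed
  also have "\<dots> = (if j - 1 \<in> {2..n-1} then x $ l 1 * y $ l (j - 1) - x $ l (j - 1) * y $ l 1 else 0)"
    by simp
  also have "j - 1 \<in> {2..n-1} \<longleftrightarrow> 3 \<le> j" using j by auto
  finally show ?thesis .
qed

lemma br_filiform_skew: "br (filiform n l) x y = - br (filiform n l) y x"
  by (auto simp: vec_eq_l br_filiform_nth)

text \<open>The coefficient at \<open>e_j\<close> of a bracket involves only the coordinates 1 and
  \<open>j - 1\<close> of its arguments, both zero for \<open>e_j\<close> when
  \<open>j \<ge> 3\<close>.\<close>

lemma br_filiform_unimodular: "lin_trace (\<lambda>y. br (filiform n l) y x) = 0"
proof -
  have "br (filiform n l) (axis (l j) 1) x $ l j = 0" if j: "j \<in> {1..n}" for j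
  proof (cases "3 \<le> j")
    case True
    then have "1 \<in> {1..n}" "j - 1 \<in> {1..n}" "j \<noteq> 1" "j \<noteq> j - 1" using j by auto
    then have "axis (l j) (1::real) $ l 1 = 0" "axis (l j) (1::real) $ l (j - 1) = 0"
      using axis_l_nth[OF j] by metis+
    then show ?thesis by (simp add: br_filiform_nth[OF j])
  qed (simp add: br_filiform_nth[OF j])
  then show ?thesis by (simp add: lin_trace_matrix sum_UNIV_l[OF n l])
qed

lemma torus_entry:
  assumes "D \<in> filiform_torus n l" "i \<in> {2..n}"
  shows "D $ l i $ l i = real (i - 2) * D $ l 1 $ l 1 + D $ l 2 $ l 2"
proof -
  obtain d2 where d: "\<And>i. i \<in> {2..n} \<Longrightarrow> D $ l i $ l i = real (i - 2) * D $ l 1 $ l 1 + d2"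
    using assms(1) by (auto simp: filiform_torus_def)
  have "D $ l 2 $ l 2 = d2" using d[of 2] n by simp
  then show ?thesis using d[OF assms(2)] by simp
qed

text \<open>Gram-Schmidt is applied in the order \<open>e_n, e_(n-1), ..., e_1\<close>, so
  \<open>u k\<close> lies in the span of \<open>e_(n-k), ..., e_n\<close>. All vectors but the last
  form an orthonormal basis of the abelian ideal spanned by \<open>e_2, ..., e_n\<close>.\<close>

lemma triangular_orthonormal_basis:
  assumes h: "inner_product h"
  obtains u :: "nat \<Rightarrow> real ^ 'n" where "orthonormal_basis h {..<n} u"
    "\<And>k j. k < n \<Longrightarrow> 1 \<le> j \<Longrightarrow> j < n - k \<Longrightarrow> u k $ l j = 0"
proof -
  define w :: "nat \<Rightarrow> real ^ 'n" where "w = (\<lambda>k. axis (l (n - k)) 1)"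
  have sub: "span (w ` {..<m}) \<subseteq> {x. \<forall>j. 1 \<le> j \<and> j \<le> n - m \<longrightarrow> x $ l j = 0}" if "m \<le> n" for m
  proof (rule span_minimal)
    show "w ` {..<m} \<subseteq> {x. \<forall>j. 1 \<le> j \<and> j \<le> n - m \<longrightarrow> x $ l j = 0}"
    proof (clarsimp simp: w_def)
      fix k j assume kj: "k < m" "Suc 0 \<le> j" "j \<le> n - m"
      then have "n - k \<in> {1..n}" "j \<in> {1..n}" "n - k \<noteq> j" using that by auto
      then show "axis (l (n - k)) (1::real) $ l j = 0" by (simp add: axis_l_nth)
    qed
    show "subspace {x :: real ^ 'n. \<forall>j. 1 \<le> j \<and> j \<le> n - m \<longrightarrow> x $ l j = 0}"
      by (rule subspaceI) auto
  qed
  have "w m \<notin> span (w ` {..<m})" if m: "m < n" for m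
  proof
    assume "w m \<in> span (w ` {..<m})"
    then have "w m $ l (n - m) = 0" using sub[of m] m by auto
    then show False by (simp add: w_def)
  qed
  then obtain u where on: "\<And>i j. i < n \<Longrightarrow> j < n \<Longrightarrow> h (u i) (u j) = (if i = j then 1 else 0)"
    and sp: "\<And>m. m \<le> n \<Longrightarrow> span (u ` {..<m}) = span (w ` {..<m})"
    using gram_schmidt[OF h, of n w] by blast
  have "Basis \<subseteq> w ` {..<n}"
  proof
    fix b :: "real ^ 'n" assume "b \<in> Basis"
    then obtain p where p: "b = axis p 1" by (auto simp: Basis_vec_def)
    obtain i where i: "i \<in> {1..n}" "p = l i" using l_cases[OF l] by metis
    then have "b = w (n - i)" "n - i < n" using p by (auto simp: w_def)
    then show "b \<in> w ` {..<n}" by blast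
  qed
  then have "span (w ` {..<n}) = UNIV" using span_mono span_Basis by blast
  then have "orthonormal_basis h {..<n} u"
    using on sp[of n] by (intro orthonormal_basisI[OF h]) auto
  moreover have "u k $ l j = 0" if kj: "k < n" "1 \<le> j" "j < n - k" for k j
  proof -
    have "u k \<in> span (u ` {..<Suc k})" by (rule span_base) simp
    then have "u k \<in> span (w ` {..<Suc k})" using sp[of "Suc k"] kj by simp
    then show ?thesis using sub[of "Suc k"] kj by auto
  qed
  ultimately show ?thesis using that by blast
qed

text \<open>The Ricci form is tested twice. At the central vector \<open>e_n\<close> the nilpotent
  contribution is nonnegative, so the negative sign must come from \<open>D $ l n $ l n > 0\<close>.
  Summed over an orthonormal basis of the abelian ideal, the nilpotent contributions cancel and only
  the trace of \<open>D\<close> on the ideal remains.\<close>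

lemma srn_positive:
  assumes D: "D \<in> srn (filiform n l) (filiform_torus n l)"
  shows "trace D > 0" and "D $ l n $ l n > 0" and "(\<Sum>i=2..n. D $ l i $ l i) > 0"
proof -
  have Dt: "D \<in> filiform_torus n l" and "strongly_ricci_negative (filiform n l) D"
    using D by (auto simp: srn_def)
  then have DD: "D \<in> Diag" using filiform_torus_subset_Diag[OF n l] by blast
  obtain g nabla where tr: "trace D > 0" and g: "inner_product g"
    and sym: "\<forall>x y. g (0, D *v x) (0, y) = g (0, x) (0, D *v y)"
    and perp: "\<forall>x. g (1, 0) (0, x) = 0"
    and lc: "levi_civita (semidirect_br (filiform n l) D) g nabla"
    and neg: "\<And>X. X \<noteq> 0 \<Longrightarrow> ricci (semidirect_br (filiform n l) D) nabla X X < 0"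
    using \<open>strongly_ricci_negative (filiform n l) D\<close> unfolding strongly_ricci_negative_def ricci_negative_def by blast
  show "trace D > 0" by (rule tr)
  define h where "h = (\<lambda>x y. g (0, x) (0, y))"
  define N where "N = g (1, 0) (1, 0)"
  have N: "N > 0" unfolding N_def by (rule inner_product_pos[OF g]) (simp add: zero_prod_def)
  have h: "inner_product h" unfolding h_def by (rule inner_product_restrict[OF g])
  note hs = inner_product_simps[OF h]
  obtain u where u: "orthonormal_basis h {..<n} u"
    and tri: "\<And>k j. k < n \<Longrightarrow> 1 \<le> j \<Longrightarrow> j < n - k \<Longrightarrow> u k $ l j = 0"
    using triangular_orthonormal_basis[OF h] by blast
  have ric: "ricci (semidirect_br (filiform n l) D) nabla (0, y) (0, y) = - trace D * h (D *v y) y / N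
    - (\<Sum>i<n. \<Sum>j<n. ((h (br (filiform n l) (u i) y) (u j) + h (br (filiform n l) (u j) y) (u i)) / 2)\<^sup>2
        - (h (br (filiform n l) (u j) (u i)) y)\<^sup>2 / 4)" for y
    using ricci_semidirect[OF g perp sym br_filiform_skew br_filiform_unimodular lc
        u[unfolded h_def], of 0 y]
    by (simp add: h_def N_def)
  show "D $ l n $ l n > 0"
  proof -
    define e :: "real ^ 'n" where "e = axis (l n) 1"
    have "e $ l j = 0" if "j \<in> {1..n-1}" for j
    proof -
      have "n \<in> {1..n}" "j \<in> {1..n}" "n \<noteq> j" using that n by auto
      then show ?thesis by (simp add: e_def axis_l_nth)
    qed
    moreover have "1 \<in> {1..n-1}" "j \<in> {1..n} \<Longrightarrow> 3 \<le> j \<Longrightarrow> j - 1 \<in> {1..n-1}" for j using n by auto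
    ultimately have "br (filiform n l) x e = 0" for x
      unfolding vec_eq_l by (simp add: br_filiform_nth del: One_nat_def)
    then have "ricci (semidirect_br (filiform n l) D) nabla (0, e) (0, e) =
      - (trace D / N) * (D $ l n $ l n * h e e) + (\<Sum>i<n. \<Sum>j<n. (h (br (filiform n l) (u j) (u i)) e)\<^sup>2 / 4)"
      using Diag_axis[OF DD] by (simp add: ric hs sum_negf e_def[symmetric]) (simp add: e_def hs)
    moreover have "e \<noteq> 0" by (simp add: e_def axis_eq_0_iff)
    moreover have "(\<Sum>i<n. \<Sum>j<n. (h (br (filiform n l) (u j) (u i)) e)\<^sup>2 / 4) \<ge> 0" by (intro sum_nonneg) simp
    ultimately have "(trace D / N) * (D $ l n $ l n * h e e) > 0"
      using neg[of "(0, e)"] by (simp add: zero_prod_def)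
    then show ?thesis
      using tr N inner_product_pos[OF h \<open>e \<noteq> 0\<close>] by (simp add: zero_less_mult_iff zero_less_divide_iff)
  qed
  \<comment> \<open>Indices start at 0, so \<open>u z\<close> with \<open>z = n - 1\<close> is the
    last basis vector, a unit normal of the ideal.\<close>
  obtain z where z: "n = Suc z" using n by (cases n) auto
  have on: "h (u i) (u j) = (if i = j then 1 else 0)" if "i < n" "j < n" for i j
    using u that by (auto simp: orthonormal_basis_def)
  have exp: "(\<Sum>i<n. h x (u i) *\<^sub>R u i) = x" for x using u by (simp add: orthonormal_basis_def)
  have u1: "u k $ l 1 = 0" if "k < z" for k using tri[of k 1] that z by simp
  \<comment> \<open>Among the basis vectors only \<open>u z\<close> has an \<open>e_1\<close>
    component, so the \<open>e_1\<close> coordinate detects the component along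
    \<open>u z\<close>.\<close>
  have exp1: "h x (u z) * u z $ l 1 = x $ l 1" for x
  proof -
    have "x $ l 1 = (\<Sum>i<Suc z. h x (u i) *\<^sub>R u i) $ l 1" using exp[of x] z by simp
    moreover have "(\<Sum>i<z. h x (u i) * u i $ l 1) = 0" using u1 by (intro sum.neutral) auto
    ultimately show ?thesis by (simp del: One_nat_def)
  qed
  have "u z $ l 1 \<noteq> 0" using exp1[of "axis (l 1) 1"] by auto
  then have uz: "h x (u z) = 0" if "x $ l 1 = 0" for x using exp1[of x] that by simp
  have one: "1 \<in> {1..n}" using n by simp
  \<comment> \<open>The matrix of the bracket with \<open>u z\<close> on the ideal; all other
    brackets of basis vectors vanish up to sign.\<close>
  define c where "c = (\<lambda>k j. h (br (filiform n l) (u z) (u k)) (u j))"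
  have ab: "br (filiform n l) (u i) (u j) = 0" if "i < z" "j < z" for i j
    using u1 that by (auto simp: vec_eq_l br_filiform_nth)
  have cz: "c k z = 0" for k unfolding c_def by (rule uz, subst br_filiform_nth[OF one]) simp
  \<comment> \<open>As the ideal is abelian, only the pairs \<open>(i, z)\<close> and
    \<open>(z, i)\<close> contribute, with equal values.\<close>
  have rk: "ricci (semidirect_br (filiform n l) D) nabla (0, u k) (0, u k)
      = - (trace D / N) * h (D *v u k) (u k) - (\<Sum>i<z. (c k i)\<^sup>2 / 2 - (c i k)\<^sup>2 / 2)" if k: "k < z" for k
  proof -
    define F where "F = (\<lambda>i j. ((h (br (filiform n l) (u i) (u k)) (u j) + h (br (filiform n l) (u j) (u k)) (u i)) / 2)\<^sup>2
        - (h (br (filiform n l) (u j) (u i)) (u k))\<^sup>2 / 4)"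
    have 1: "F i j = 0" if "i < z" "j < z" for i j using ab that k by (simp add: F_def hs)
    have 2: "F i z = (c k i)\<^sup>2 / 4 - (c i k)\<^sup>2 / 4" if "i < z" for i
      using ab[OF that k] by (simp add: F_def hs c_def power_divide)
    have 3: "F z i = (c k i)\<^sup>2 / 4 - (c i k)\<^sup>2 / 4" if "i < z" for i
      using ab[OF that k] br_filiform_skew[of "u i" "u z"] by (simp add: F_def hs c_def power_divide)
    have "br (filiform n l) (u z) (u z) = 0" by (auto simp: vec_eq_l br_filiform_nth)
    then have 4: "F z z = 0" using cz[of k] by (simp add: F_def c_def hs)
    have "(\<Sum>i<n. \<Sum>j<n. F i j) = (\<Sum>i<z. \<Sum>j<z. F i j) + (\<Sum>i<z. F i z) + (\<Sum>j<z. F z j) + F z z"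
      unfolding z lessThan_Suc by (simp add: sum.distrib)
    also have "\<dots> = (\<Sum>i<z. (c k i)\<^sup>2 / 4 - (c i k)\<^sup>2 / 4) + (\<Sum>i<z. (c k i)\<^sup>2 / 4 - (c i k)\<^sup>2 / 4)"
      using 1 2 3 4 by simp
    also have "\<dots> = (\<Sum>i<z. (c k i)\<^sup>2 / 2 - (c i k)\<^sup>2 / 2)"
      unfolding sum.distrib[symmetric] by (intro sum.cong refl) simp
    finally show ?thesis unfolding ric F_def by simp
  qed
  have "(\<Sum>k<z. ricci (semidirect_br (filiform n l) D) nabla (0, u k) (0, u k)) = - (trace D / N) * (\<Sum>k<z. h (D *v u k) (u k))"
  proof -
    \<comment> \<open>The summand changes sign when \<open>i\<close> and \<open>k\<close> are
      exchanged.\<close>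
    have "(\<Sum>k<z. \<Sum>i<z. (c k i)\<^sup>2 / 2 - (c i k)\<^sup>2 / 2) = 0"
      unfolding sum_subtractf by (subst (2) sum.swap) simp
    then show ?thesis by (simp add: rk sum_subtractf sum_distrib_left sum_negf)
  qed
  moreover have "(\<Sum>k<z. ricci (semidirect_br (filiform n l) D) nabla (0, u k) (0, u k)) < 0"
  proof -
    have "u k \<noteq> 0" if "k < z" for k using on[of k k] that z by (auto simp: hs)
    then have "(\<Sum>k<z. - ricci (semidirect_br (filiform n l) D) nabla (0, u k) (0, u k)) > 0"
      using n z neg by (intro sum_pos) (auto simp: zero_prod_def)
    then show ?thesis by (simp add: sum_negf)
  qed
  moreover have "(\<Sum>k<z. h (D *v u k) (u k)) = (\<Sum>i=2..n. D $ l i $ l i)"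
  proof -
    have "(\<Sum>k<n. h (D *v u k) (u k)) = trace D"
      using lin_trace_orthonormal[OF h u matrix_vector_mul_linear, of D] lin_trace_matrix_vector[of D] by simp
    \<comment> \<open>\<open>D *v u z\<close> minus \<open>D $ l 1 $ l 1\<close> times
      \<open>u z\<close> has no \<open>e_1\<close> component, so it lies in the ideal and is
      orthogonal to \<open>u z\<close>.\<close>
    moreover have "h (D *v u z) (u z) = D $ l 1 $ l 1"
    proof -
      have "h (D *v u z - D $ l 1 $ l 1 *\<^sub>R u z) (u z) = 0"
        by (rule uz) (simp add: Diag_mult_vector[OF DD])
      then show ?thesis using on[of z z] z by (simp add: hs)
    qed
    ultimately show ?thesis using trace_eq_sum_l[OF n l DD] z by simp
  qed
  ultimately have "(trace D / N) * (\<Sum>i=2..n. D $ l i $ l i) > 0" by simp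
  then show "(\<Sum>i=2..n. D $ l i $ l i) > 0"
    using tr N by (simp add: zero_less_mult_iff zero_less_divide_iff)
qed

end

text \<open>Take \<open>f\<close> of length 1 and a diagonal metric with weights \<open>q i\<close>.
  The ratios of weights are free, so the nilpotent Ricci operator can be made \<open>t\<close> times
  the diagonal operator with the entries on the left of \<open>b_D\<close>. Those inequalities then
  make the full Ricci form negative.\<close>

lemma in_srn:
  fixes n :: nat and l :: "nat \<Rightarrow> 'n::finite"
  assumes n: "3 < n" and l: "bij_betw l {1..n} UNIV"
    and D: "D \<in> filiform_torus n l" and tr: "trace D > 0"
    and b: "\<And>i. i \<in> {2..n-1} \<Longrightarrow> b i > 0"
    and b_D: "\<And>j. j \<in> {1..n} \<Longrightarrow> (if 3 \<le> j then b (j - 1) else 0)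
      - (if 2 \<le> j \<and> j \<le> n - 1 then b j else 0)
      - (if j = 1 then \<Sum>i=2..n-1. b i else (0::real)) < D $ l j $ l j"
  shows "D \<in> srn (filiform n l) (filiform_torus n l)"
proof -
  have DD: "D \<in> Diag" and der: "derivation (filiform n l) D" using D filiform_torus_eq[OF l n] by auto
  define t where "t = trace D"
  \<comment> \<open>The squared structure constants in the normalised basis are
    \<open>q (i + 1) / q i\<close>. The factor 2 compensates the 1/2 in the nilpotent Ricci
    operator, and \<open>t\<close> matches the factor \<open>trace D\<close> in front of
    \<open>D\<close>.\<close>
  define c where "c = (\<lambda>i. if i \<in> {2..n-1} then 2 * t * b i else 1)"
  have "c i > 0" for i using b[of i] tr by (simp add: c_def t_def)
  then obtain q where q: "\<And>i. q i > (0::real)" "q 1 = 1" "\<And>i. 2 \<le> i \<Longrightarrow> q (i + 1) = c i * q i"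
    using recursive_product[of c] by blast
  have q_Suc: "q (i + 1) = 2 * t * b i * q i" if "i \<in> {2..n-1}" for i
    using q(3)[of i] that by (simp add: c_def)
  define h where "h = (\<lambda>x y :: real ^ 'n. \<Sum>i=1..n. q i * x $ l i * y $ l i)"
  define g where "g = (\<lambda>X Y :: real \<times> (real ^ 'n). fst X * fst Y + h (snd X) (snd Y))"
  have h_pos: "h x x > 0" if "x \<noteq> 0" for x
  proof -
    obtain j where j: "j \<in> {1..n}" "x $ l j \<noteq> 0"
      using \<open>x \<noteq> 0\<close> vec_eq_l[OF n l, of x 0] unfolding zero_index by blast
    have "0 < q j * x $ l j * x $ l j" using j q(1)[of j] by (auto simp: mult.assoc zero_less_mult_iff linorder_neq_iff)
    also have "\<dots> \<le> h x x"
      unfolding h_def using j q(1) by (intro member_le_sum) (auto simp: mult.assoc less_imp_le)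
    finally show ?thesis .
  qed
  have g: "inner_product g"
    unfolding inner_product_def
  proof (intro conjI allI impI)
    show "linear (\<lambda>X. g X Y)" for Y
      by (rule linearI) (simp_all add: g_def h_def sum.distrib sum_distrib_left algebra_simps)
    show "g X Y = g Y X" for X Y
      by (simp add: g_def h_def mult_ac)
    show "g X X > 0" if "X \<noteq> 0" for X
    proof (cases "snd X = 0")
      case True
      then have "fst X \<noteq> 0" using that by (simp add: prod_eq_iff)
      then show ?thesis using True by (auto simp: g_def h_def zero_less_mult_iff linorder_neq_iff)
    next
      case False
      then show ?thesis using h_pos by (simp add: g_def add_nonneg_pos)
    qed
  qed
  have gh: "g (0, x) (0, y) = h x y" for x y by (simp add: g_def)
  have h: "inner_product h" using inner_product_restrict[OF g] by (simp add: gh)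
  note hs = inner_product_simps[OF h]
  have perp: "\<forall>x. g (1, 0) (0, x) = 0" by (simp add: g_def h_def)
  have sym: "\<forall>x y. g (0, D *v x) (0, y) = g (0, x) (0, D *v y)"
    by (simp add: gh h_def Diag_mult_vector[OF DD] mult_ac)
  obtain nabla where lc: "levi_civita (semidirect_br (filiform n l) D) g nabla"
  proof -
    have "semidirect_br (filiform n l) D X Y = - semidirect_br (filiform n l) D Y X" for X Y
      using br_filiform_skew[OF n l, of "snd X" "snd Y"] by (simp add: semidirect_br_def)
    then show ?thesis
      using ex1_levi_civita[OF g linear_semidirect_br_left linear_semidirect_br_right] that by blast
  qed
  define s where "s = (\<lambda>i. sqrt (q i))"
  have s: "s i \<noteq> 0" "s i * s i = q i" for i using q(1)[of i] by (simp_all add: s_def)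
  define v :: "nat \<Rightarrow> real ^ 'n" where "v = (\<lambda>i. axis (l i) (1 / s i))"
  have v_nth: "v i $ l j = (if i = j then 1 / s i else 0)" if "i \<in> {1..n}" "j \<in> {1..n}" for i j
    unfolding v_def by (rule axis_l_nth[OF n l that])
  have h_axis: "h x (axis (l j) 1) = q j * x $ l j" if j: "j \<in> {1..n}" for x j
  proof -
    have "h x (axis (l j) 1) = (\<Sum>i=1..n. if i = j then q j * x $ l j else 0)"
      unfolding h_def using j by (intro sum.cong refl) (simp add: axis_l_nth[OF n l])
    then show ?thesis using j by simp
  qed
  have v_axis: "v i = (1 / s i) *\<^sub>R axis (l i) 1" for i
    by (simp add: v_def vec_eq_iff axis_def)
  have h_v: "h x (v j) = s j * x $ l j" if j: "j \<in> {1..n}" for x j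
    using s(1)[of j] h_axis[OF j, of x] by (simp add: v_axis hs s(2)[symmetric])
  have v: "orthonormal_basis (\<lambda>x y. g (0, x) (0, y)) {1..n} v"
    unfolding orthonormal_basis_def gh
  proof (intro conjI ballI allI)
    show "h (v i) (v j) = (if i = j then 1 else 0)" if "i \<in> {1..n}" "j \<in> {1..n}" for i j
      using that by (simp add: h_v v_nth s(1))
    show "(\<Sum>i\<in>{1..n}. h x (v i) *\<^sub>R v i) = x" for x
      unfolding vec_eq_l[OF n l]
    proof
      fix j assume j: "j \<in> {1..n}"
      have "(\<Sum>i\<in>{1..n}. h x (v i) *\<^sub>R v i) $ l j = (\<Sum>i\<in>{1..n}. if i = j then x $ l j else 0)"
        unfolding sum_component using j
        by (intro sum.cong refl) (auto simp: h_v v_nth s(1))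
      then show "(\<Sum>i\<in>{1..n}. h x (v i) *\<^sub>R v i) $ l j = x $ l j" using j by simp
    qed
  qed simp
  \<comment> \<open>The Ricci form is diagonal in \<open>a\<close> and the coordinates of
    \<open>y\<close>. Apart from the weight \<open>q j\<close>, the coefficient at \<open>j\<close>
    is \<open>- t\<close> times the gap in the inequality \<open>b_D\<close>.\<close>
  have ricci: "ricci (semidirect_br (filiform n l) D) nabla (a, y) (a, y) =
      - a\<^sup>2 * (\<Sum>i=1..n. (D $ l i $ l i)\<^sup>2)
      - t * (\<Sum>j=1..n. q j * (y $ l j)\<^sup>2 * (D $ l j $ l j
        - ((if 3 \<le> j then b (j - 1) else 0) - (if 2 \<le> j \<and> j \<le> n - 1 then b j else 0)
          - (if j = 1 then \<Sum>i=2..n-1. b i else 0))))" for a y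
  proof -
    define d where "d = (\<lambda>i. D $ l i $ l i)"
    define Y where "Y = (\<lambda>i. y $ l i)"
    have hD: "h (D *v v i) (v j) = (if i = j then d i else 0)" if "i \<in> {1..n}" "j \<in> {1..n}" for i j
      using that by (simp add: h_v v_nth s(1) Diag_mult_vector[OF DD] d_def)
    \<comment> \<open>The matrix of the bracket with \<open>y\<close>, in the orthonormal basis
      \<open>v\<close>.\<close>
    define \<tau> where "\<tau> = (\<lambda>i j. h (br (filiform n l) (v i) y) (v j))"
    have \<tau>: "\<tau> i j = (if 3 \<le> j then (if i = 1 then s j * Y (j - 1) else 0)
        - (if i = j - 1 then s j * Y 1 / s (j - 1) else 0) else 0)"
      if ij: "i \<in> {1..n}" "j \<in> {1..n}" for i j
    proof (cases "3 \<le> j")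
      case True
      then have r: "1 \<in> {1..n}" "j - 1 \<in> {1..n}" using ij by auto
      have "s 1 = 1" by (simp add: s_def q(2) del: One_nat_def)
      then show ?thesis
        using True
        by (auto simp: \<tau>_def h_v[OF ij(2)] br_filiform_nth[OF n l ij(2)] v_nth[OF ij(1) r(1)]
            v_nth[OF ij(1) r(2)] Y_def simp del: One_nat_def)
    qed (simp add: \<tau>_def h_v[OF ij(2)] br_filiform_nth[OF n l ij(2)])
    define \<kappa> where "\<kappa> = (\<lambda>i j. h (br (filiform n l) (v j) (v i)) y)"
    \<comment> \<open>The squared inner product of \<open>y\<close> with the bracket of
      \<open>v 1\<close> and \<open>v i\<close>.\<close>
    define G where "G = (\<lambda>i. (q (i + 1) * Y (i + 1))\<^sup>2 / q i)"
    have \<kappa>: "(\<kappa> i j)\<^sup>2 = (if j = 1 then (if 2 \<le> i \<and> i \<le> n - 1 then G i else 0) else 0)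
        + (if i = 1 then (if 2 \<le> j \<and> j \<le> n - 1 then G j else 0) else 0)"
      if ij: "i \<in> {1..n}" "j \<in> {1..n}" for i j
    proof -
      have "s 1 = 1" by (simp add: s_def q(2) del: One_nat_def)
      have hy: "h (axis (l (k + 1)) 1) y = q (k + 1) * Y (k + 1)" if "2 \<le> k" "k \<le> n - 1" for k
      proof -
        have "k + 1 \<in> {1..n}" using that by auto
        then show ?thesis using h_axis inner_product_sym[OF h] by (simp add: Y_def)
      qed
      have "br (filiform n l) (v j) (v i) = (1 / s j * (1 / s i)) *\<^sub>R br (filiform n l) (axis (l j) 1) (axis (l i) 1)"
        by (simp add: v_axis linear_scale[OF linear_br_left] linear_scale[OF linear_br_right] del: br_axis)
      then show ?thesis
        unfolding \<kappa>_def using filiform_brackets[OF l ij(2,1)] hy \<open>s 1 = 1\<close> s(2)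
        by (auto simp: hs G_def power2_eq_square simp del: br_axis One_nat_def)
    qed
    have "(\<Sum>i=1..n. \<Sum>j=1..n. ((\<tau> i j + \<tau> j i) / 2 - a * h (D *v v i) (v j))\<^sup>2 - (\<kappa> i j)\<^sup>2 / 4)
        = (\<Sum>i=1..n. \<Sum>j=1..n. (\<tau> i j)\<^sup>2 / 4) + (\<Sum>i=1..n. \<Sum>j=1..n. (\<tau> j i)\<^sup>2 / 4)
          + (\<Sum>i=1..n. \<Sum>j=1..n. if i = j then a\<^sup>2 * (d i)\<^sup>2 else 0)
          - (\<Sum>i=1..n. \<Sum>j=1..n. (\<kappa> i j)\<^sup>2 / 4)"
      unfolding sum.distrib[symmetric] sum_subtractf[symmetric]
    proof (intro sum.cong refl)
      fix i j assume ij: "i \<in> {1..n}" "j \<in> {1..n}"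
      \<comment> \<open>For \<open>i \<noteq> j\<close> at most one of \<open>\<tau> i j\<close> and
        \<open>\<tau> j i\<close> is nonzero, so the square has no cross term. The terms mixing
        \<open>a\<close> and \<open>y\<close> vanish because \<open>\<tau>\<close> has zero diagonal
        while \<open>D\<close> is diagonal.\<close>
      have "i \<noteq> j \<Longrightarrow> \<tau> i j * \<tau> j i = 0" "\<tau> i i = 0" using ij by (auto simp: \<tau>)
      then show "((\<tau> i j + \<tau> j i) / 2 - a * h (D *v v i) (v j))\<^sup>2 - (\<kappa> i j)\<^sup>2 / 4 =
          (\<tau> i j)\<^sup>2 / 4 + (\<tau> j i)\<^sup>2 / 4 + (if i = j then a\<^sup>2 * (d i)\<^sup>2 else 0) - (\<kappa> i j)\<^sup>2 / 4"
        unfolding hD[OF ij] by (cases "i = j") (auto simp: power2_eq_square field_simps)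
    qed
    also have "(\<Sum>i=1..n. \<Sum>j=1..n. (\<tau> j i)\<^sup>2 / 4) = (\<Sum>i=1..n. \<Sum>j=1..n. (\<tau> i j)\<^sup>2 / 4)"
      by (rule sum.swap)
    also have "(\<Sum>i=1..n. \<Sum>j=1..n. (\<tau> i j)\<^sup>2 / 4) = t / 2 * (\<Sum>i=2..n-1. b i * (q i * (Y i)\<^sup>2 + q 1 * (Y 1)\<^sup>2))"
    proof -
      have "(\<Sum>i=1..n. \<Sum>j=1..n. (\<tau> i j)\<^sup>2 / 4) = (\<Sum>j=1..n. \<Sum>i=1..n. (\<tau> i j)\<^sup>2 / 4)" by (rule sum.swap)
      also have "\<dots> = (\<Sum>j=1..n. if 3 \<le> j then t / 2 * (b (j - 1) * (q (j - 1) * (Y (j - 1))\<^sup>2 + q 1 * (Y 1)\<^sup>2)) else 0)"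
      proof (intro sum.cong refl)
        fix j assume j: "j \<in> {1..n}"
        show "(\<Sum>i=1..n. (\<tau> i j)\<^sup>2 / 4)
          = (if 3 \<le> j then t / 2 * (b (j - 1) * (q (j - 1) * (Y (j - 1))\<^sup>2 + q 1 * (Y 1)\<^sup>2)) else 0)"
        proof (cases "3 \<le> j")
          case True
          then have r: "j - 1 \<in> {2..n-1}" "j - 1 \<in> {1..n}" "1 \<in> {1..n}" "j - 1 \<noteq> 1" "j - 1 + 1 = j" using j by auto
          have "(\<Sum>i=1..n. (\<tau> i j)\<^sup>2 / 4) = (\<Sum>i=1..n. (if i = 1 then (s j * Y (j - 1))\<^sup>2 / 4 else 0)
              + (if i = j - 1 then (s j * Y 1 / s (j - 1))\<^sup>2 / 4 else 0))"
            (is "_ = sum ?f _")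
          proof (intro sum.cong refl)
            show "(\<tau> i j)\<^sup>2 / 4 = ?f i" if "i \<in> {1..n}" for i
              unfolding \<tau>[OF that j] using True r(4) by auto
          qed
          also have "\<dots> = (s j * Y (j - 1))\<^sup>2 / 4 + (s j * Y 1 / s (j - 1))\<^sup>2 / 4"
            unfolding sum.distrib using r(2,3) by (simp del: One_nat_def)
          also have "\<dots> = q j * (Y (j - 1))\<^sup>2 / 4 + q j / q (j - 1) * (Y 1)\<^sup>2 / 4"
            by (simp add: power2_eq_square s(2)[symmetric] mult_ac)
          also have "q j = 2 * t * b (j - 1) * q (j - 1)" using q_Suc[OF r(1)] r(5) by simp
          finally show ?thesis using True q(1)[of "j - 1"] q(2) by (simp add: field_simps)
        next
          case False
          then show ?thesis using j by (simp add: \<tau>)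
        qed
      qed
      also have "\<dots> = (\<Sum>i=2..n-1. t / 2 * (b i * (q i * (Y i)\<^sup>2 + q 1 * (Y 1)\<^sup>2)))"
        by (rule sum_pred_interval)
      finally show ?thesis by (simp add: sum_distrib_left)
    qed
    also have "(\<Sum>i=1..n. \<Sum>j=1..n. (\<kappa> i j)\<^sup>2 / 4) = t * (\<Sum>i=2..n-1. b i * (q (i + 1) * (Y (i + 1))\<^sup>2))"
    proof -
      have one: "1 \<in> {1..n}" using n by simp
      have e: "(\<Sum>j=1..n. if 2 \<le> j \<and> j \<le> n - 1 then G j else 0) = (\<Sum>i=2..n-1. G i)"
        by (rule sum_inner_interval)
      have "(\<Sum>i=1..n. \<Sum>j=1..n. (\<kappa> i j)\<^sup>2) = (\<Sum>i=1..n. (if 2 \<le> i \<and> i \<le> n - 1 then G i else 0)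
          + (if i = 1 then (\<Sum>i=2..n-1. G i) else 0))"
      proof (intro sum.cong refl)
        fix i assume i: "i \<in> {1..n}"
        have "(\<Sum>j=1..n. (\<kappa> i j)\<^sup>2) = (\<Sum>j=1..n. if j = 1 then (if 2 \<le> i \<and> i \<le> n - 1 then G i else 0) else 0)
          + (\<Sum>j=1..n. if i = 1 then (if 2 \<le> j \<and> j \<le> n - 1 then G j else 0) else 0)"
          unfolding sum.distrib[symmetric] by (intro sum.cong refl \<kappa>[OF i])
        also have "(\<Sum>j=1..n. if j = 1 then (if 2 \<le> i \<and> i \<le> n - 1 then G i else 0) else 0)
            = (if 2 \<le> i \<and> i \<le> n - 1 then G i else 0)"
          using one by (subst sum.delta) auto
        also have "(\<Sum>j=1..n. if i = 1 then (if 2 \<le> j \<and> j \<le> n - 1 then G j else 0) else 0)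
            = (if i = 1 then (\<Sum>i=2..n-1. G i) else 0)"
          using e by (cases "i = 1") (simp_all only: if_True if_False sum.neutral_const simp_thms)
        finally show "(\<Sum>j=1..n. (\<kappa> i j)\<^sup>2) = (if 2 \<le> i \<and> i \<le> n - 1 then G i else 0)
            + (if i = 1 then (\<Sum>i=2..n-1. G i) else 0)" .
      qed
      also have "\<dots> = 2 * (\<Sum>i=2..n-1. G i)"
        unfolding sum.distrib e using one by (simp del: One_nat_def)
      also have "\<dots> = 4 * (t * (\<Sum>i=2..n-1. b i * (q (i + 1) * (Y (i + 1))\<^sup>2)))"
        unfolding sum_distrib_left
      proof (intro sum.cong refl)
        fix i assume i: "i \<in> {2..n-1}"
        have "G i = 2 * t * b i * (q (i + 1) * (Y (i + 1))\<^sup>2)"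
        proof -
          have "q (i + 1) / q i = 2 * t * b i" using q_Suc[OF i] q(1)[of i] by simp
          moreover have "G i = q (i + 1) / q i * (q (i + 1) * (Y (i + 1))\<^sup>2)"
            by (simp add: G_def power2_eq_square)
          ultimately show ?thesis by simp
        qed
        then show "2 * G i = 4 * (t * (b i * (q (i + 1) * (Y (i + 1))\<^sup>2)))" by simp
      qed
      finally show ?thesis unfolding sum_divide_distrib[symmetric] by simp
    qed
    also have "(\<Sum>i=1..n. \<Sum>j=1..n. if i = j then a\<^sup>2 * (d i)\<^sup>2 else 0) = a\<^sup>2 * (\<Sum>i=1..n. (d i)\<^sup>2)"
      by (simp add: sum_distrib_left)
    finally have S: "(\<Sum>i=1..n. \<Sum>j=1..n. ((\<tau> i j + \<tau> j i) / 2 - a * h (D *v v i) (v j))\<^sup>2 - (\<kappa> i j)\<^sup>2 / 4)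
        = t * (\<Sum>i=2..n-1. b i * (q i * (Y i)\<^sup>2 + q 1 * (Y 1)\<^sup>2)) + a\<^sup>2 * (\<Sum>i=1..n. (d i)\<^sup>2)
          - t * (\<Sum>i=2..n-1. b i * (q (i + 1) * (Y (i + 1))\<^sup>2))" by simp
    have R: "(\<Sum>j=1..n. q j * (Y j)\<^sup>2 * (d j
        - ((if 3 \<le> j then b (j - 1) else 0) - (if 2 \<le> j \<and> j \<le> n - 1 then b j else 0)
          - (if j = 1 then \<Sum>i=2..n-1. b i else 0))))
      = (\<Sum>j=1..n. q j * (Y j)\<^sup>2 * d j) - (\<Sum>i=2..n-1. b i * (q (i + 1) * (Y (i + 1))\<^sup>2))
        + (\<Sum>i=2..n-1. b i * (q i * (Y i)\<^sup>2)) + q 1 * (Y 1)\<^sup>2 * (\<Sum>i=2..n-1. b i)"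
    proof -
      \<comment> \<open>Writing \<open>j\<close> as \<open>j - 1 + 1\<close> makes the shifted
        summand a function of \<open>j - 1\<close>, as \<open>sum_pred_interval\<close>
        requires.\<close>
      have "(\<Sum>j=1..n. q j * (Y j)\<^sup>2 * (d j
        - ((if 3 \<le> j then b (j - 1) else 0) - (if 2 \<le> j \<and> j \<le> n - 1 then b j else 0)
          - (if j = 1 then \<Sum>i=2..n-1. b i else 0))))
        = (\<Sum>j=1..n. q j * (Y j)\<^sup>2 * d j)
          - (\<Sum>j=1..n. if 3 \<le> j then b (j - 1) * (q (j - 1 + 1) * (Y (j - 1 + 1))\<^sup>2) else 0)
          + (\<Sum>j=1..n. if 2 \<le> j \<and> j \<le> n - 1 then b j * (q j * (Y j)\<^sup>2) else 0)
          + (\<Sum>j=1..n. if j = 1 then q 1 * (Y 1)\<^sup>2 * (\<Sum>i=2..n-1. b i) else 0)"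
        unfolding sum.distrib[symmetric] sum_subtractf[symmetric]
        by (intro sum.cong refl) (auto simp: algebra_simps)
      moreover have "(\<Sum>j=1..n. if j = 1 then q 1 * (Y 1)\<^sup>2 * (\<Sum>i=2..n-1. b i) else 0)
          = q 1 * (Y 1)\<^sup>2 * (\<Sum>i=2..n-1. b i)" using n by (subst sum.delta) auto
      ultimately show ?thesis
        unfolding sum_pred_interval[of "\<lambda>i. b i * (q (i + 1) * (Y (i + 1))\<^sup>2)"] sum_inner_interval by simp
    qed
    have H: "h (D *v y) y = (\<Sum>j=1..n. q j * (Y j)\<^sup>2 * d j)"
      by (simp add: h_def Diag_mult_vector[OF DD] Y_def d_def power2_eq_square mult_ac)
    have P: "(\<Sum>i=2..n-1. b i * (q i * (Y i)\<^sup>2 + q 1 * (Y 1)\<^sup>2))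
        = (\<Sum>i=2..n-1. b i * (q i * (Y i)\<^sup>2)) + q 1 * (Y 1)\<^sup>2 * (\<Sum>i=2..n-1. b i)"
      by (simp add: distrib_left sum.distrib sum_distrib_left mult_ac)
    have Ric: "ricci (semidirect_br (filiform n l) D) nabla (a, y) (a, y) = - t * h (D *v y) y
        - (\<Sum>i=1..n. \<Sum>j=1..n. ((\<tau> i j + \<tau> j i) / 2 - a * h (D *v v i) (v j))\<^sup>2 - (\<kappa> i j)\<^sup>2 / 4)"
    proof -
      have "g (1, 0) (1, 0) = 1" by (simp add: g_def h_def)
      then show ?thesis
        unfolding ricci_semidirect[OF g perp sym br_filiform_skew[OF n l] br_filiform_unimodular[OF n l] lc v]
        by (simp add: gh t_def \<tau>_def \<kappa>_def)
    qed
    have "D $ l j $ l j = d j" "y $ l j = Y j" for j by (simp_all add: d_def Y_def)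
    then show ?thesis
      unfolding Ric S H P by (simp only: R) (simp add: distrib_left right_diff_distrib)
  qed
  have "ricci (semidirect_br (filiform n l) D) nabla X X < 0" if "X \<noteq> 0" for X
  proof -
    obtain a y where X: "X = (a, y)" by fastforce
    define R where "R = (\<lambda>j. D $ l j $ l j
        - ((if 3 \<le> j then b (j - 1) else 0) - (if 2 \<le> j \<and> j \<le> n - 1 then b j else 0)
          - (if j = 1 then \<Sum>i=2..n-1. b i else 0)))"
    have R: "R j > 0" if "j \<in> {1..n}" for j using b_D[OF that] by (simp only: R_def diff_gt_0_iff_gt)
    have S0: "(\<Sum>j=1..n. q j * (y $ l j)\<^sup>2 * R j) \<ge> 0"
      using q(1) R by (intro sum_nonneg mult_nonneg_nonneg) (auto simp: less_imp_le)
    have t: "t > 0" using tr by (simp add: t_def)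
    have d: "(\<Sum>i=1..n. (D $ l i $ l i)\<^sup>2) > 0"
    proof (rule ccontr)
      assume "\<not> (\<Sum>i=1..n. (D $ l i $ l i)\<^sup>2) > 0"
      moreover have "(\<Sum>i=1..n. (D $ l i $ l i)\<^sup>2) \<ge> 0" by (intro sum_nonneg) simp
      ultimately have "(\<Sum>i=1..n. (D $ l i $ l i)\<^sup>2) = 0" by linarith
      then have "\<forall>i\<in>{1..n}. D $ l i $ l i = 0" by (subst (asm) sum_nonneg_eq_0_iff) auto
      then have "trace D = 0" by (simp add: trace_def sum_UNIV_l[OF n l])
      then show False using tr by simp
    qed
    have eq: "ricci (semidirect_br (filiform n l) D) nabla X X
        = - (a\<^sup>2 * (\<Sum>i=1..n. (D $ l i $ l i)\<^sup>2)) - t * (\<Sum>j=1..n. q j * (y $ l j)\<^sup>2 * R j)"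
      unfolding X ricci R_def by simp
    show ?thesis
    proof (cases "a = 0")
      case True
      then have "y \<noteq> 0" using that X by (simp add: zero_prod_def)
      then obtain j where j: "j \<in> {1..n}" "y $ l j \<noteq> 0"
        using \<open>y \<noteq> 0\<close> vec_eq_l[OF n l, of y 0] unfolding zero_index by blast
      have "0 < q j * (y $ l j)\<^sup>2 * R j" using j q(1) R by simp
      also have "\<dots> \<le> (\<Sum>j=1..n. q j * (y $ l j)\<^sup>2 * R j)"
        using j q(1) R by (intro member_le_sum) (auto simp: less_imp_le)
      finally show ?thesis unfolding eq using t True by simp
    next
      case False
      then have "a\<^sup>2 * (\<Sum>i=1..n. (D $ l i $ l i)\<^sup>2) > 0" using d by simp
      moreover have "t * (\<Sum>j=1..n. q j * (y $ l j)\<^sup>2 * R j) \<ge> 0" using S0 t by simp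
      ultimately show ?thesis unfolding eq by linarith
    qed
  qed
  then have "ricci_negative (semidirect_br (filiform n l) D) g" using lc unfolding ricci_negative_def by blast
  then show ?thesis
    unfolding srn_def strongly_ricci_negative_def using D der tr g sym perp by blast
qed

section \<open>Equality of the cone with the strongly Ricci negative derivations\<close>

theorem corollary1p6:
  fixes n :: nat and l :: "nat \<Rightarrow> 'n::finite"
  assumes "n > 3" and "bij_betw l {1..n} (UNIV :: 'n set)"
  shows "cone_C (filiform n l) (filiform_torus n l) = srn (filiform n l) (filiform_torus n l)"
proof -
  let ?t = "filiform_torus n l"
  \<comment> \<open>The same coefficients \<open>b\<close> produce both the point of the orbit and
    the metric.\<close>
  have *: "D \<in> cone_C (filiform n l) ?t \<and> D \<in> srn (filiform n l) ?t"
    if D: "D \<in> ?t" "trace D > 0" and pos: "D $ l n $ l n > 0" "(\<Sum>i=2..n. D $ l i $ l i) > 0" for D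
  proof -
    obtain b where "\<And>i. i \<in> {2..n-1} \<Longrightarrow> b i > 0"
      and "\<And>j. j \<in> {1..n} \<Longrightarrow> (if 3 \<le> j then b (j - 1) else 0)
        - (if 2 \<le> j \<and> j \<le> n - 1 then b j else 0)
        - (if j = 1 then \<Sum>i=2..n-1. b i else (0::real)) < D $ l j $ l j"
      using filiform_coefficients[OF assms(1) torus_entry[OF assms D(1)] refl pos] by blast
    then show ?thesis using in_cone_C[OF assms D] in_srn[OF assms D] by blast
  qed
  show ?thesis
  proof (intro set_eqI iffI)
    fix D assume D: "D \<in> cone_C (filiform n l) ?t"
    then have "D \<in> ?t" "trace D > 0" by (auto simp: cone_C_def)
    then show "D \<in> srn (filiform n l) ?t" using * cone_C_positive[OF assms D] by blast
  next
    fix D assume D: "D \<in> srn (filiform n l) ?t"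
    then have "D \<in> ?t" by (simp add: srn_def)
    then show "D \<in> cone_C (filiform n l) ?t" using * srn_positive[OF assms D] by blast
  qed
qed

end
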